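(* Let $d\ge1$, let $\Omega\subset\mathbb{R}^d$ be a non-empty bounded open set and let $u\in W_1(\Omega)$. Then, for any representative of $u$ and any representative of $\partial_1u$, again denoted by $u$ and $\partial_1u$, there exists a measurable set $A_1\subset\mathcal{P}_1(\Omega)$ whose complementary in $\mathcal{P}_1(\Omega)$ is $\lambda^{d-1}$-negligible such that, for all $y\in A_1$, the function defined for all $s\in\omega_1(y)$ by $f(s)=u(s,y)$ is such that $f\in H^1(\omega_1(y))$ with, for Lebesgue-a.e. $s\in\omega_1(y)$, $Df(s)=\partial_1u(s,y)$, where $Df$ denotes the weak derivative of $f$ in the open set $\omega_1(y)$.
   Context: Points of $\mathbb{R}^d$ are written $x=(s,y)$ with $s\in\mathbb{R}$, $y\in\mathbb{R}^{d-1}$. For $\varphi\in C_c^\infty(\Omega)$, $\partial_1\varphi$ is the partial derivative with respect to the first argument. For $u\in L^2(\Omega)$, $\partial_1u\in L^2(\Omega)$ means that there exists $v\in L^2(\Omega)$ (then unique, denoted $\partial_1u$) with $\int_\Omega u\,\partial_1\varphi\,\mathrm{d}x=-\int_\Omega v\,\varphi\,\mathrm{d}x$ for all $\varphi\in C_c^\infty(\Omega)$. $W_1(\Omega)=\{u\in L^2(\Omega):\partial_1u\in L^2(\Omega)\}$. $\mathcal{P}_1(\Omega)=\{y\in\mathbb{R}^{d-1}:\exists s\in\mathbb{R},\ (s,y)\in\Omega\}$ and, for $y\in\mathcal{P}_1(\Omega)$, $\omega_1(y)=\{s\in\mathbb{R}:(s,y)\in\Omega\}$, an open subset of $\mathbb{R}$.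 $\lambda^{d-1}$ is the Lebesgue measure on $\mathbb{R}^{d-1}$. *)

theory Defs
  imports "HOL-Analysis.Analysis"
begin

definition has_partials :: "'a::euclidean_space \<Rightarrow> ('a \<Rightarrow> real) \<Rightarrow> bool" where
  "has_partials e f \<longleftrightarrow> (\<forall>x. (\<lambda>t. f (x + t *\<^sub>R e)) differentiable (at (0::real)))"

definition partial :: "'a::euclidean_space \<Rightarrow> ('a \<Rightarrow> real) \<Rightarrow> 'a \<Rightarrow> real" where
  "partial e f x = deriv (\<lambda>t. f (x + t *\<^sub>R e)) 0"

primrec C_k :: "nat \<Rightarrow> ('a::euclidean_space \<Rightarrow> real) \<Rightarrow> bool" where
  "C_k 0 f \<longleftrightarrow> continuous_on UNIV f"
| "C_k (Suc n) f \<longleftrightarrow>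
     continuous_on UNIV f \<and> (\<forall>e\<in>Basis. has_partials e f \<and> C_k n (partial e f))"

(* C_c^\<infinity>(\<Omega>), each test function being identified with its extension by zero to the whole space *)
definition test_functions :: "'a::euclidean_space set \<Rightarrow> ('a \<Rightarrow> real) set" where
  "test_functions \<Omega> = {\<phi>. (\<forall>n. C_k n \<phi>) \<and>
     compact (closure {x. \<phi> x \<noteq> 0}) \<and> closure {x. \<phi> x \<noteq> 0} \<subseteq> \<Omega>}"

(* Elements are representatives, not classes modulo a.e. equality; only their values on \<Omega> matter. *)
definition L2 :: "'a::euclidean_space set \<Rightarrow> ('a \<Rightarrow> real) set" where
  "L2 \<Omega> = {u. u \<in> borel_measurable (lebesgue_on \<Omega>) \<and> integrable (lebesgue_on \<Omega>) (\<lambda>x. (u x)\<^sup>2)}"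

(* v is a representative of the weak partial derivative of u along the basis vector e *)
definition has_weak_partial ::
    "'a::euclidean_space \<Rightarrow> 'a set \<Rightarrow> ('a \<Rightarrow> real) \<Rightarrow> ('a \<Rightarrow> real) \<Rightarrow> bool" where
  "has_weak_partial e \<Omega> u v \<longleftrightarrow> v \<in> L2 \<Omega> \<and>
     (\<forall>\<phi>\<in>test_functions \<Omega>.
        integral\<^sup>L (lebesgue_on \<Omega>) (\<lambda>x. u x * partial e \<phi> x) =
        - integral\<^sup>L (lebesgue_on \<Omega>) (\<lambda>x. v x * \<phi> x))"

definition W :: "'a::euclidean_space \<Rightarrow> 'a set \<Rightarrow> ('a \<Rightarrow> real) set" where
  "W e \<Omega> = {u \<in> L2 \<Omega>. \<exists>v. has_weak_partial e \<Omega> u v}"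

abbreviation has_weak_deriv :: "real set \<Rightarrow> (real \<Rightarrow> real) \<Rightarrow> (real \<Rightarrow> real) \<Rightarrow> bool" where
  "has_weak_deriv \<omega> \<equiv> has_weak_partial 1 \<omega>"

abbreviation H1 :: "real set \<Rightarrow> (real \<Rightarrow> real) set" where
  "H1 \<omega> \<equiv> W 1 \<omega>"

(* The distinguished coordinate k of real^'n plays the role of the first one.  The space
   R^(d-1) of the remaining coordinates consists of the functions in
   extensional (UNIV - {k}); it is a single point when d = 1, a case which no type of
   class euclidean_space covers. *)
definition point :: "'n \<Rightarrow> real \<Rightarrow> ('n \<Rightarrow> real) \<Rightarrow> real ^ 'n::finite" where
  "point k s y = (\<chi> i. if i = k then s else y i)"

definition proj :: "'n \<Rightarrow> (real ^ 'n::finite) set \<Rightarrow> ('n \<Rightarrow> real) set" where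
  "proj k \<Omega> = {y \<in> extensional (UNIV - {k}). \<exists>s. point k s y \<in> \<Omega>}"

definition slice :: "'n \<Rightarrow> (real ^ 'n::finite) set \<Rightarrow> ('n \<Rightarrow> real) \<Rightarrow> real set" where
  "slice k \<Omega> y = {s. point k s y \<in> \<Omega>}"

(* Lebesgue measure on R^(d-1); the unit mass on a single point when d = 1 *)
definition lebesgue_rest :: "'n::finite \<Rightarrow> ('n \<Rightarrow> real) measure" where
  "lebesgue_rest k = completion (PiM (UNIV - {k}) (\<lambda>_. lborel))"

end

theory Submission
  imports Defs
begin

text \<open>Testing the weak derivative in \<open>\<real>\<^sup>d\<close> against products \<open>h(s) \<eta>(y)\<close> supported in a rational box and
  letting \<open>\<eta>\<close> increase to the indicator of a box in the remaining variables, Fubini shows that for almost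
  every \<open>y\<close> the slice satisfies the weak derivative identity against \<open>h\<close>. The exceptional null set may only
  depend on countably many \<open>h\<close>; we take a fixed bump on a rational interval times a monomial. An arbitrary
  test function on the slice is a \<open>C\<^sup>1\<close> function times a finite sum of such bumps, and Weierstrass
  approximation of the \<open>C\<^sup>1\<close> factor recovers the identity.\<close>

text \<open>The family of test functions on a slice is uncountable and itself changes with
  \<open>y\<close>. A countable substitute is enough because, for integrable \<open>U\<close>,
  \<open>V\<close> of bounded support, \<open>pairing U V\<close> is continuous in the
  \<open>C^1\<close> norm on an interval \<open>{-R..R}\<close> and makes sense for functions
  without compact support: the bumps localise, the polynomials approximate. Boundedness of \<Omega>
  enters twice: it puts \<open>L^2\<close> inside \<open>L^1\<close>, and it keeps each slice in a
  bounded interval. Measurability is the other obstacle: a section of a Lebesgue measurable function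
  can fail to be measurable. Fubini is therefore applied to Borel representatives extended by zero,
  and the completed measure in \<open>y\<close> returns only in the final statement. Indexing the
  remaining coordinates by \<open>UNIV - {k}\<close> treats dimension one like the others: the
  product is then a single point of mass one.\<close>

section \<open>Algebra of \<open>C_k\<close> functions\<close>

lemma C_k_continuous: "C_k n f \<Longrightarrow> continuous_on UNIV f"
  by (cases n) auto

text \<open>Since \<open>partial\<close> is defined through \<open>deriv\<close>, exhibiting a
  derivative identifies it. Smoothness proofs can thus name the derivative by a formula and apply
  the induction hypothesis to that formula.\<close>

lemma C_k_SucI:
  fixes f :: "'a::euclidean_space \<Rightarrow> real"
  assumes "continuous_on UNIV f"
    and "\<And>e x. e \<in> Basis \<Longrightarrow> ((\<lambda>t. f (x + t *\<^sub>R e)) has_real_derivative f' e x) (at 0)"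
    and "\<And>e. e \<in> Basis \<Longrightarrow> C_k n (f' e)"
  shows "C_k (Suc n) f"
proof -
  have "partial e f = f' e" if "e \<in> Basis" for e
    using assms(2)[OF that] by (auto simp: partial_def fun_eq_iff intro!: DERIV_imp_deriv)
  then show ?thesis
    using assms by (auto simp: has_partials_def real_differentiable_def)
qed

lemma C_k_SucD:
  assumes "C_k (Suc n) f" and "e \<in> Basis"
  shows "((\<lambda>t. f (x + t *\<^sub>R e)) has_real_derivative partial e f x) (at 0)"
    and "C_k n (partial e f)"
  using assms by (auto simp: has_partials_def partial_def DERIV_deriv_iff_real_differentiable)

lemma C_k_Suc_imp: "C_k (Suc n) f \<Longrightarrow> C_k n f"
  by (induction n arbitrary: f) auto

lemma C_k_const: "C_k n (\<lambda>x. c)"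
proof (induction n arbitrary: c)
  case (Suc n)
  show ?case by (rule C_k_SucI[where f' = "\<lambda>_ _. 0"]) (auto simp: Suc.IH)
qed auto

lemma C_k_add:
  assumes "C_k n f" "C_k n g"
  shows "C_k n (\<lambda>x. f x + g x)"
  using assms
proof (induction n arbitrary: f g)
  case 0
  then show ?case by (auto intro: continuous_intros)
next
  case (Suc n)
  show ?case
    by (rule C_k_SucI[where f' = "\<lambda>e x. partial e f x + partial e g x"])
      (use Suc in \<open>auto intro!: continuous_intros DERIV_add C_k_SucD[of n] Suc.IH
        simp del: C_k.simps(2) dest: C_k_continuous\<close>)
qed

lemma C_k_mult:
  assumes "C_k n f" "C_k n g"
  shows "C_k n (\<lambda>x. f x * g x)"
  using assms
proof (induction n arbitrary: f g)
  case 0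
  then show ?case by (auto intro: continuous_intros)
next
  case (Suc n)
  show ?case
  proof (rule C_k_SucI[where f' = "\<lambda>e x. partial e f x * g x + partial e g x * f x"])
    show "continuous_on UNIV (\<lambda>x. f x * g x)"
      using Suc.prems by (auto intro!: continuous_intros)
    fix e x :: 'a assume e: "e \<in> Basis"
    show "((\<lambda>t. f (x + t *\<^sub>R e) * g (x + t *\<^sub>R e)) has_real_derivative
        partial e f x * g x + partial e g x * f x) (at 0)"
      using DERIV_mult[OF C_k_SucD(1)[OF Suc.prems(1) e] C_k_SucD(1)[OF Suc.prems(2) e]] by simp
  next
    fix e :: 'a assume e: "e \<in> Basis"
    show "C_k n (\<lambda>x. partial e f x * g x + partial e g x * f x)"
      using Suc.prems e by (intro C_k_add Suc.IH C_k_SucD(2)) (auto intro: C_k_Suc_imp simp del: C_k.simps)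
  qed
qed

lemma C_k_sum:
  assumes "\<And>i. i \<in> I \<Longrightarrow> C_k n (f i)"
  shows "C_k n (\<lambda>x. \<Sum>i\<in>I. f i x)"
  using assms by (induction I rule: infinite_finite_induct) (auto intro: C_k_const C_k_add)

lemma C_k_prod:
  assumes "\<And>i. i \<in> I \<Longrightarrow> C_k n (f i)"
  shows "C_k n (\<lambda>x. \<Prod>i\<in>I. f i x)"
  using assms by (induction I rule: infinite_finite_induct) (auto intro: C_k_const C_k_mult)

lemma C_k_power: "C_k n f \<Longrightarrow> C_k n (\<lambda>x. f x ^ m)"
  by (induction m) (auto intro: C_k_const C_k_mult)

lemma C_k_id: "C_k n (\<lambda>x::real. x)"
proof (cases n)
  case (Suc m)
  show ?thesis unfolding Suc
    by (rule C_k_SucI[where f' = "\<lambda>_ _. 1"])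
      (auto intro!: C_k_const derivative_eq_intros)
qed auto

lemma DERIV_iff_at_0:
  fixes h :: "real \<Rightarrow> real"
  shows "(h has_real_derivative D) (at x) \<longleftrightarrow> ((\<lambda>t. h (x + t)) has_real_derivative D) (at 0)"
  using DERIV_at_within_shift[of h D x 0 UNIV] by simp

lemma C_k_Suc_real:
  assumes "C_k (Suc n) (h :: real \<Rightarrow> real)"
  shows "(h has_real_derivative partial 1 h x) (at x)" and "C_k n (partial 1 h)"
  using C_k_SucD[OF assms, of 1] by (simp_all add: DERIV_iff_at_0[of h])

text \<open>Unit vectors \<open>w\<close> give the coordinate factors of a product test function; on
  the line, \<open>w = c\<close> and \<open>w = - c\<close> give the rescaled and reflected factors
  of \<open>bump\<close>.\<close>

lemma C_k_compose_inner:
  fixes w :: "'a::euclidean_space"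
  assumes "C_k n h"
  shows "C_k n (\<lambda>x. h (w \<bullet> x + d))"
  using assms
proof (induction n arbitrary: h)
  case 0
  then show ?case by (auto intro!: continuous_on_compose2[of UNIV h] continuous_intros)
next
  case (Suc n)
  show ?case
  proof (rule C_k_SucI[where f' = "\<lambda>e x. (w \<bullet> e) * partial 1 h (w \<bullet> x + d)"])
    show "continuous_on UNIV (\<lambda>x. h (w \<bullet> x + d))"
      using Suc.prems by (auto intro!: continuous_on_compose2[of UNIV h] continuous_intros)
    fix e x :: 'a
    show "((\<lambda>t. h (w \<bullet> (x + t *\<^sub>R e) + d)) has_real_derivative w \<bullet> e * partial 1 h (w \<bullet> x + d)) (at 0)"
      by (rule DERIV_chain'[where f = "\<lambda>t. w \<bullet> (x + t *\<^sub>R e) + d" and D = "w \<bullet> e", THEN DERIV_cong])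
        (use C_k_Suc_real(1)[OF Suc.prems] in \<open>auto intro!: derivative_eq_intros simp: inner_add_right mult.commute\<close>)
  next
    fix e :: 'a
    show "C_k n (\<lambda>x. (w \<bullet> e) * partial 1 h (w \<bullet> x + d))"
      by (intro C_k_mult C_k_const Suc.IH C_k_Suc_real Suc.prems)
  qed
qed

section \<open>Smooth bumps on intervals\<close>

text \<open>\<open>flat 0\<close> is the classical smooth function that is flat at the origin. The
  powers in the denominator close the family under differentiation, up to linear combinations, so
  one induction over all \<open>m\<close> gives smoothness.\<close>

definition flat :: "nat \<Rightarrow> real \<Rightarrow> real" where
  "flat m x = (if x > 0 then exp (- 1 / x) / x ^ m else 0)"

lemma flat_nonneg: "0 \<le> flat m x"
  by (simp add: flat_def)

text \<open>The exponential series at \<open>1 / x\<close> exceeds its term of degree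
  \<open>m + 2\<close>. Two powers beyond \<open>m\<close> leave a factor \<open>x\<^sup>2\<close>,
  which makes the difference quotient at 0 tend to 0.\<close>

lemma flat_le_sq: "flat m x \<le> fact (m + 2) * x\<^sup>2"
proof (cases "x > 0")
  case True
  have "(1 / x) ^ (m + 2) / fact (m + 2) \<le> exp (1 / x)"
  proof -
    have "(1 / x) ^ (m + 2) / fact (m + 2) = (\<Sum>k\<in>{m + 2}. (1 / x) ^ k /\<^sub>R fact k)"
      by (simp add: divide_inverse)
    also have "\<dots> \<le> (\<Sum>k. (1 / x) ^ k /\<^sub>R fact k)"
      using True by (intro sum_le_suminf summable_exp_generic) auto
    finally show ?thesis by (simp add: exp_def)
  qed
  then show ?thesis
    using True by (simp add: flat_def exp_minus field_simps power_add power2_eq_square del: fact_Suc)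
qed (auto simp: flat_def)

lemma DERIV_flat: "(flat m has_real_derivative flat (m + 2) x - m * flat (m + 1) x) (at x)"
proof -
  consider "x > 0" | "x < 0" | "x = 0" by linarith
  then show ?thesis
  proof cases
    case 1
    have P: "((\<lambda>x. x ^ m) has_real_derivative m * x ^ m / x) (at x)"
      by (rule DERIV_cong[OF DERIV_pow]) (use 1 in \<open>cases m; simp\<close>)
    have "((\<lambda>x. exp (- 1 / x) / x ^ m) has_real_derivative flat (m + 2) x - m * flat (m + 1) x) (at x)"
      using 1 by (auto intro!: derivative_eq_intros DERIV_divide[OF _ P, THEN DERIV_cong]
        simp: flat_def field_simps power2_eq_square)
    then show ?thesis
      by (rule has_field_derivative_transform_within_open[where S = "{0<..}"])
        (use 1 in \<open>auto simp: flat_def\<close>)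
  next
    case 2
    have "((\<lambda>x. 0) has_real_derivative 0) (at x)" by simp
    then have "(flat m has_real_derivative 0) (at x)"
      by (rule has_field_derivative_transform_within_open[where S = "{..<0}"])
        (use 2 in \<open>auto simp: flat_def\<close>)
    then show ?thesis using 2 by (simp add: flat_def)
  next
    case 3
    have "((\<lambda>h. flat m h / h) \<longlongrightarrow> 0) (at 0)"
    proof (rule Lim_null_comparison)
      show "\<forall>\<^sub>F h in at 0. norm (flat m h / h) \<le> fact (m + 2) * \<bar>h\<bar>"
        using flat_le_sq[of m] flat_nonneg[of m]
        by (intro eventuallyI) (auto simp: divide_simps power2_eq_square mult.assoc abs_mult simp del: fact_Suc)
      show "((\<lambda>h::real. fact (m + 2) * \<bar>h\<bar>) \<longlongrightarrow> 0) (at 0)"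
        by (auto intro!: tendsto_eq_intros simp del: fact_Suc)
    qed
    then have "(flat m has_real_derivative 0) (at 0)"
      by (simp add: DERIV_def flat_def)
    then show ?thesis using 3 by (simp add: flat_def)
  qed
qed

lemma C_k_flat: "C_k n (flat m)"
proof (induction n arbitrary: m)
  case 0
  show ?case by (auto intro!: continuous_at_imp_continuous_on DERIV_isCont[OF DERIV_flat])
next
  case (Suc n)
  show ?case
  proof (rule C_k_SucI[where f' = "\<lambda>_ x. flat (m + 2) x + (- real m) * flat (m + 1) x"])
    show "continuous_on UNIV (flat m)"
      by (auto intro!: continuous_at_imp_continuous_on DERIV_isCont[OF DERIV_flat])
  next
    show "C_k n (\<lambda>x. flat (m + 2) x + (- real m) * flat (m + 1) x)"
      by (intro C_k_add C_k_mult C_k_const Suc.IH)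
  qed (use DERIV_flat in \<open>auto simp: DERIV_iff_at_0[symmetric]\<close>)
qed

text \<open>The scale \<open>c\<close> changes the steepness but not the support: every
  \<open>c > 0\<close> gives positivity exactly on the open interval, and \<open>c\<close> tending
  to infinity gives its indicator. The direction \<open>s\<close> uses \<open>c = 1\<close>, the
  other directions use \<open>c = Suc n\<close>, which is never 0.\<close>

definition bump :: "real \<Rightarrow> real \<Rightarrow> real \<Rightarrow> real \<Rightarrow> real" where
  "bump c a b x = flat 0 (c * (x - a)) * flat 0 (c * (b - x))"

lemma C_k_bump: "C_k n (bump c a b)"
proof -
  have "C_k n (\<lambda>x. flat 0 (c \<bullet> x + (- c * a)) * flat 0 ((- c) \<bullet> x + c * b))"
    by (intro C_k_mult C_k_compose_inner C_k_flat)
  also have "(\<lambda>x. flat 0 (c \<bullet> x + (- c * a)) * flat 0 ((- c) \<bullet> x + c * b)) = bump c a b"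
    by (auto simp: bump_def fun_eq_iff algebra_simps)
  finally show ?thesis .
qed

lemma bump_bounds: "0 \<le> bump c a b x" "bump c a b x \<le> 1"
proof -
  have "flat 0 t \<le> 1" for t by (simp add: flat_def)
  then show "0 \<le> bump c a b x" "bump c a b x \<le> 1"
    by (auto simp: bump_def flat_nonneg intro!: mult_le_one)
qed

lemma bump_pos_iff: "c > 0 \<Longrightarrow> bump c a b x > 0 \<longleftrightarrow> x \<in> {a<..<b}"
  by (auto simp: bump_def flat_def zero_less_mult_iff split: if_splits)

lemma bump_eq_0: "c > 0 \<Longrightarrow> x \<notin> {a<..<b} \<Longrightarrow> bump c a b x = 0"
  using bump_pos_iff[of c a b x] bump_bounds(1)[of c a b x] by linarith

lemma bump_tendsto_indicator:
  "(\<lambda>n. bump (Suc n) a b x) \<longlonglongrightarrow> indicator {a<..<b} x"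
proof (cases "x \<in> {a<..<b}")
  case True
  have "(\<lambda>n. exp (- 1 / (real (Suc n) * t))) \<longlonglongrightarrow> 1" if "t > 0" for t
    using tendsto_exp[OF tendsto_mult_right[OF LIMSEQ_inverse_real_of_nat, of "- 1 / t"]]
    by (simp add: field_simps)
  from tendsto_mult[OF this[of "x - a"] this[of "b - x"]] True show ?thesis
    by (simp add: bump_def flat_def del: of_nat_Suc)
qed (simp add: bump_eq_0 del: of_nat_Suc)

section \<open>The weak derivative pairing on the line and its continuity in
  \<open>C^1\<close>\<close>

lemma partial_real_eqI:
  assumes "(h has_real_derivative D) (at x)"
  shows "partial 1 h x = D"
  using assms unfolding partial_def DERIV_iff_at_0[of h] by (auto intro: DERIV_imp_deriv)

lemma C_1_realI:
  assumes "\<And>x. (h has_real_derivative h' x) (at x)" "continuous_on UNIV h'"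
  shows "C_k (Suc 0) h"
  by (rule C_k_SucI[where f' = "\<lambda>_. h'"])
    (use assms in \<open>auto simp: DERIV_iff_at_0[symmetric] intro!: continuous_at_imp_continuous_on DERIV_isCont\<close>)

lemma C_1_real_continuous:
  assumes "C_k (Suc 0) (h :: real \<Rightarrow> real)"
  shows "continuous_on A h" "continuous_on A (partial 1 h)"
  using C_k_continuous[OF assms] C_k_Suc_real(2)[OF assms]
  by (auto intro: continuous_on_subset)

lemma partial_real_add:
  assumes "C_k (Suc 0) f" "C_k (Suc 0) g"
  shows "partial 1 (\<lambda>x::real. f x + g x) x = partial 1 f x + partial 1 g x"
  by (intro partial_real_eqI DERIV_add C_k_Suc_real(1)[of 0] assms)

lemma partial_real_mult:
  assumes "C_k (Suc 0) f" "C_k (Suc 0) g"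
  shows "partial 1 (\<lambda>x::real. f x * g x) x = partial 1 f x * g x + f x * partial 1 g x"
  using DERIV_mult[OF C_k_Suc_real(1)[OF assms(1)] C_k_Suc_real(1)[OF assms(2)]]
  by (intro partial_real_eqI) (simp add: mult.commute)

lemma partial_real_cmult:
  assumes "C_k (Suc 0) f"
  shows "partial 1 (\<lambda>x::real. c * f x) x = c * partial 1 f x"
  by (intro partial_real_eqI DERIV_cmult C_k_Suc_real(1)[of 0] assms)

lemma compact_continuous_bound:
  fixes h :: "real \<Rightarrow> real"
  assumes "continuous_on {-R..R} h"
  shows "\<exists>B\<ge>0. \<forall>x\<in>{-R..R}. \<bar>h x\<bar> \<le> B"
proof -
  have "bounded (h ` {-R..R})"
    by (intro compact_imp_bounded compact_continuous_image assms) auto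
  then obtain B where "\<forall>x\<in>{-R..R}. \<bar>h x\<bar> \<le> B"
    by (auto simp: bounded_iff)
  then show ?thesis by (intro exI[of _ "max B 0"]) (auto simp: le_max_iff_disj)
qed

lemma integrable_mult_continuous:
  fixes U h :: "real \<Rightarrow> real"
  assumes "integrable lborel U" "\<And>x. x \<notin> {-R..R} \<Longrightarrow> U x = 0" "continuous_on UNIV h"
  shows "integrable lborel (\<lambda>x. U x * h x)"
proof -
  obtain B where B: "B \<ge> 0" "\<And>x. x \<in> {-R..R} \<Longrightarrow> \<bar>h x\<bar> \<le> B"
    using compact_continuous_bound[OF continuous_on_subset[OF assms(3) subset_UNIV]] by blast
  have [measurable]: "h \<in> borel_measurable borel"
    using assms(3) by (rule borel_measurable_continuous_onI)
  have [measurable]: "U \<in> borel_measurable borel"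
    using assms(1) by (simp add: borel_measurable_integrable)
  show ?thesis
  proof (rule Bochner_Integration.integrable_bound[where f = "\<lambda>x. B * U x"])
    have "\<bar>U x * h x\<bar> \<le> \<bar>B * U x\<bar>" for x
    proof (cases "x \<in> {-R..R}")
      case True
      then show ?thesis
        using mult_left_mono[OF B(2)[OF True], of "\<bar>U x\<bar>"] B(1) by (simp add: abs_mult mult.commute)
    qed (simp add: assms(2))
    then show "AE x in lborel. norm (U x * h x) \<le> norm (B * U x)" by simp
  qed (use assms(1) in auto)
qed

text \<open>When \<open>U\<close> and \<open>V\<close> extend a function and its candidate
  derivative by zero, vanishing of the pairing is the weak derivative identity against
  \<open>h\<close>. Integrating over the whole line lets \<open>h\<close> be a polynomial.\<close>

definition pairing :: "(real \<Rightarrow> real) \<Rightarrow> (real \<Rightarrow> real) \<Rightarrow> (real \<Rightarrow> real) \<Rightarrow> real" where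
  "pairing U V h = (\<integral>x. U x * partial 1 h x + V x * h x \<partial>lborel)"

text \<open>Weierstrass is applied to the derivative; the antiderivative of the approximating
  polynomial with the value \<open>g 0\<close> at 0 is then close to \<open>g\<close> as well, by
  the mean value inequality.\<close>

lemma C_1_polynomial_approx:
  assumes g: "C_k (Suc 0) g" and "e > 0" and "R > 0"
  shows "\<exists>c n. \<forall>x\<in>{-R..R}. \<bar>g x - (\<Sum>i\<le>n::nat. c i * x ^ i)\<bar> \<le> e \<and>
    \<bar>partial 1 g x - partial 1 (\<lambda>x. \<Sum>i\<le>n. c i * x ^ i) x\<bar> \<le> e"
proof -
  \<comment> \<open>The bound \<open>e\<close> serves the derivatives; the bound
    \<open>e / R\<close> serves the values, whose error grows by a factor of at most
    \<open>R\<close> on integration from 0.\<close>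
  define d where "d = min e (e / R)"
  have d: "d > 0" "d \<le> e" "d * R \<le> e"
    using assms by (auto simp: d_def min_def field_simps)
  obtain p where p: "real_polynomial_function p"
    "\<And>x. x \<in> {-R..R} \<Longrightarrow> \<bar>partial 1 g x - p x\<bar> < d"
    using Stone_Weierstrass_real_polynomial_function[of "{-R..R}" "partial 1 g" d]
      C_1_real_continuous(2)[OF g] d(1) by auto
  obtain a n where a: "p = (\<lambda>x. \<Sum>i\<le>n. a i * x ^ i)"
    using real_polynomial_function_imp_sum[OF p(1)] by auto
  \<comment> \<open>Coefficients of the antiderivative of \<open>p\<close>, with constant term
    \<open>g 0\<close>.\<close>
  define c where "c i = (case i of 0 \<Rightarrow> g 0 | Suc j \<Rightarrow> a j / Suc j)" for i
  define q where "q x = (\<Sum>i\<le>Suc n. c i * x ^ i)" for x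
  have q_eq: "q x = g 0 + (\<Sum>i\<le>n. a i / Suc i * x ^ Suc i)" for x
    unfolding q_def by (subst sum.atMost_Suc_shift) (simp add: c_def)
  have Dq: "(q has_real_derivative p x) (at x)" for x
  proof -
    have "((\<lambda>x. g 0 + (\<Sum>i\<le>n. a i / Suc i * x ^ Suc i)) has_real_derivative
        0 + (\<Sum>i\<le>n. a i / Suc i * (real (Suc i) * x ^ (Suc i - Suc 0)))) (at x)"
      by (intro DERIV_add DERIV_const DERIV_sum DERIV_cmult DERIV_pow)
    moreover have "(\<Sum>i\<le>n. a i / Suc i * (real (Suc i) * x ^ (Suc i - Suc 0))) = p x"
      unfolding a by (intro sum.cong) (auto simp del: of_nat_Suc)
    ultimately show ?thesis
      unfolding q_eq[abs_def] by simp
  qed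
  have "\<bar>g x - q x\<bar> \<le> e" if x: "x \<in> {-R..R}" for x
  proof -
    have "norm ((g x - q x) - (g 0 - q 0)) \<le> d * norm (x - 0)"
    proof (rule field_differentiable_bound[where S = "{-R..R}"])
      show "((\<lambda>x. g x - q x) has_real_derivative partial 1 g z - p z) (at z within {-R..R})" for z
        by (intro DERIV_diff has_field_derivative_at_within[OF C_k_Suc_real(1)[OF g]]
            has_field_derivative_at_within[OF Dq])
      show "norm (partial 1 g z - p z) \<le> d" if "z \<in> {-R..R}" for z
        using p(2)[OF that] by simp
    qed (use x \<open>R > 0\<close> in auto)
    also have "d * norm (x - 0) \<le> d * R"
      using x d(1) by (intro mult_left_mono) auto
    finally show ?thesis
      using d(3) by (simp add: q_eq)
  qed
  moreover have "\<bar>partial 1 g x - partial 1 q x\<bar> \<le> e" if x: "x \<in> {-R..R}" for x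
    using p(2)[OF x] d(2) partial_real_eqI[OF Dq, of x] by simp
  ultimately show ?thesis
    unfolding q_def[abs_def] by blast
qed

context
  fixes U V :: "real \<Rightarrow> real" and R :: real
  assumes U: "integrable lborel U" "\<And>x. x \<notin> {-R..R} \<Longrightarrow> U x = 0"
    and V: "integrable lborel V" "\<And>x. x \<notin> {-R..R} \<Longrightarrow> V x = 0"
begin

lemma integrable_pairing:
  assumes "C_k (Suc 0) h"
  shows "integrable lborel (\<lambda>x. U x * partial 1 h x)" "integrable lborel (\<lambda>x. V x * h x)"
  using integrable_mult_continuous[OF U C_1_real_continuous(2)[OF assms]]
    integrable_mult_continuous[OF V C_1_real_continuous(1)[OF assms]] by simp_all

lemma pairing_add:
  assumes "C_k (Suc 0) f" "C_k (Suc 0) g"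
  shows "pairing U V (\<lambda>x. f x + g x) = pairing U V f + pairing U V g"
  unfolding pairing_def partial_real_add[OF assms] using assms
  by (subst Bochner_Integration.integral_add[symmetric])
    (auto simp: algebra_simps intro!: Bochner_Integration.integrable_add integrable_pairing Bochner_Integration.integral_cong)

lemma pairing_cmult:
  assumes "C_k (Suc 0) f"
  shows "pairing U V (\<lambda>x. c * f x) = c * pairing U V f"
proof -
  have "U x * (c * partial 1 f x) + V x * (c * f x) = c * (U x * partial 1 f x + V x * f x)" for x
    by (simp add: algebra_simps)
  then show ?thesis
    unfolding pairing_def partial_real_cmult[OF assms] by simp
qed

lemma pairing_sum:
  assumes "\<And>i. i \<in> I \<Longrightarrow> C_k (Suc 0) (f i)"
  shows "pairing U V (\<lambda>x. \<Sum>i\<in>I. f i x) = (\<Sum>i\<in>I. pairing U V (f i))"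
proof -
  have 0: "pairing U V (\<lambda>_. 0) = 0"
    using pairing_cmult[OF C_k_const, of 0 0] by simp
  show ?thesis using assms
  proof (induction I rule: infinite_finite_induct)
    case (insert i I)
    then show ?case
      using pairing_add[of "f i" "\<lambda>x. \<Sum>i\<in>I. f i x"] C_k_sum[of I "Suc 0" f] by auto
  qed (simp_all add: 0)
qed

text \<open>This is the \<open>C^1\<close> continuity of the pairing: outside \<open>{-R..R}\<close>
  both \<open>U\<close> and \<open>V\<close> vanish, so the size of \<open>h\<close> there is
  irrelevant. It controls the error of polynomial approximation.\<close>

lemma pairing_bound:
  assumes h: "C_k (Suc 0) h"
    and "\<And>x. x \<in> {-R..R} \<Longrightarrow> \<bar>h x\<bar> \<le> e" "\<And>x. x \<in> {-R..R} \<Longrightarrow> \<bar>partial 1 h x\<bar> \<le> e"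
  shows "\<bar>pairing U V h\<bar> \<le> ((\<integral>x. \<bar>U x\<bar> \<partial>lborel) + (\<integral>x. \<bar>V x\<bar> \<partial>lborel)) * e"
proof -
  have b: "\<bar>W x * k x\<bar> \<le> \<bar>W x\<bar> * e"
    if "x \<in> {-R..R} \<Longrightarrow> \<bar>k x\<bar> \<le> e" "x \<notin> {-R..R} \<Longrightarrow> W x = 0"
    for W k :: "real \<Rightarrow> real" and x
    using that by (cases "x \<in> {-R..R}") (auto simp: abs_mult intro!: mult_left_mono)
  have "\<bar>pairing U V h\<bar> \<le> (\<integral>x. \<bar>U x\<bar> * e + \<bar>V x\<bar> * e \<partial>lborel)"
    unfolding pairing_def real_norm_def[symmetric]
  proof (rule order_trans[OF integral_norm_bound integral_mono])
    show "norm (U x * partial 1 h x + V x * h x) \<le> norm (U x) * e + norm (V x) * e" for x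
      using b[of x "partial 1 h" U] b[of x h V] assms(2,3)[of x] U(2)[of x] V(2)[of x] by auto
  qed (use integrable_pairing[OF h] U V in \<open>auto intro!: integrable_norm Bochner_Integration.integrable_add\<close>)
  also have "\<dots> = ((\<integral>x. \<bar>U x\<bar> \<partial>lborel) + (\<integral>x. \<bar>V x\<bar> \<partial>lborel)) * e"
    using U V by (subst Bochner_Integration.integral_add) (auto simp: distrib_right)
  finally show ?thesis .
qed

text \<open>Dividing a test function by a sum of bumps leaves a \<open>C\<^sup>1\<close> function, which polynomials approximate;
  so the countably many products of a bump and a monomial suffice to test against.\<close>

lemma pairing_eq_0_from_bumps:
  assumes R: "R > 0" and \<psi>: "C_k (Suc 0) \<psi>"
    and S: "finite S" "closure {x. \<psi> x \<noteq> 0} \<subseteq> (\<Union>p\<in>S. {fst p<..<snd p})"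
    and zero: "\<And>a b m. (a, b) \<in> S \<Longrightarrow> pairing U V (\<lambda>x. bump 1 a b x * x ^ m) = 0"
  shows "pairing U V \<psi> = 0"
proof -
  \<comment> \<open>Nonnegative summands, one of them positive at each point of the union of
    intervals: \<sigma> is positive on the support of \<psi>, and dividing by it replaces a
    partition of unity.\<close>
  define \<sigma> where "\<sigma> x = (\<Sum>(a, b)\<in>S. bump 1 a b x)" for x
  have \<sigma>: "C_k (Suc 0) \<sigma>"
    unfolding \<sigma>_def[abs_def] split_beta by (intro C_k_sum C_k_bump)
  define K where "K = closure {x. \<psi> x \<noteq> 0}"
  have \<psi>_0: "\<psi> x = 0" if "x \<notin> K" for x
    using that closure_subset[of "{x. \<psi> x \<noteq> 0}"] by (auto simp: K_def)
  have \<sigma>_pos: "\<sigma> x \<noteq> 0" if x: "x \<in> K" for x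
  proof -
    obtain p where p: "p \<in> S" "x \<in> {fst p<..<snd p}"
      using x S(2) by (auto simp: K_def)
    then have "0 < \<sigma> x"
      unfolding \<sigma>_def using bump_bounds(1) bump_pos_iff[of 1 "fst p" "snd p" x]
      by (intro sum_pos2[OF S(1) p(1)]) (auto simp: split_beta)
    then show ?thesis by simp
  qed
  \<comment> \<open>Where \<sigma> vanishes the quotient has the default value 0. Such points lie
    outside the support, so \<psi> is 0 there too and \<open>\<psi> x = \<sigma> x * g x\<close>
    holds everywhere.\<close>
  define g where "g x = \<psi> x / \<sigma> x" for x
  define g' where "g' x = (partial 1 \<psi> x * \<sigma> x - \<psi> x * partial 1 \<sigma> x) / (\<sigma> x * \<sigma> x)" for x
  \<comment> \<open>The complement of \<open>K\<close> is open, so \<psi>, \<open>g\<close> and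
    \<open>g'\<close> vanish near each of its points and the zeros of \<sigma> do no harm. On
    \<open>K\<close> the quotient rule applies.\<close>
  have g0: "(g has_real_derivative 0) (at x)" "isCont g' x" "g' x = 0" if "x \<notin> K" for x
  proof -
    have op: "open (- K)" by (simp add: K_def open_Compl)
    have D0: "(\<psi> has_real_derivative 0) (at y)" "(g has_real_derivative 0) (at y)" if "y \<notin> K" for y
      by (rule has_field_derivative_transform_within_open[OF DERIV_const[of 0] op];
          use that \<psi>_0 in \<open>auto simp: g_def\<close>)+
    then show "(g has_real_derivative 0) (at x)" using that by simp
    have g'0: "g' y = 0" if "y \<notin> K" for y
      using that by (simp add: g'_def \<psi>_0 partial_real_eqI[OF D0(1)])
    then show "g' x = 0" using that by simp
    show "isCont g' x"
      using isCont_cong[of g' "\<lambda>_. 0" x]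
        eventually_mono[OF eventually_nhds_in_open[OF op, of x], of "\<lambda>y. g' y = 0"] g'0 that by simp
  qed
  have cont: "isCont h x" if "continuous_on UNIV h" for h :: "real \<Rightarrow> real" and x
    using that by (simp add: continuous_on_eq_continuous_at)
  have "C_k (Suc 0) g"
  proof (rule C_1_realI)
    fix x
    show "(g has_real_derivative g' x) (at x)"
    proof (cases "x \<in> K")
      case True
      then show ?thesis
        unfolding g_def[abs_def] g'_def
        by (intro DERIV_divide C_k_Suc_real(1)[of 0] \<psi> \<sigma> \<sigma>_pos)
    qed (use g0 in simp)
  next
    have "isCont g' x" for x
    proof (cases "x \<in> K")
      case True
      then show ?thesis
        unfolding g'_def[abs_def] using \<sigma>_pos[OF True]
        by (intro continuous_intros cont C_1_real_continuous \<psi> \<sigma>) auto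
    qed (use g0 in simp)
    then show "continuous_on UNIV g'"
      by (simp add: continuous_at_imp_continuous_on)
  qed
  note g = this
  have \<psi>_eq: "\<psi> x = \<sigma> x * g x" for x
    using \<psi>_0[of x] \<sigma>_pos[of x] by (cases "x \<in> K") (auto simp: g_def)
  obtain B where B: "B \<ge> 0" "\<And>x. x \<in> {-R..R} \<Longrightarrow> \<bar>\<sigma> x\<bar> \<le> B"
    using compact_continuous_bound[OF C_1_real_continuous(1)[OF \<sigma>]] by blast
  obtain B' where B': "B' \<ge> 0" "\<And>x. x \<in> {-R..R} \<Longrightarrow> \<bar>partial 1 \<sigma> x\<bar> \<le> B'"
    using compact_continuous_bound[OF C_1_real_continuous(2)[OF \<sigma>]] by blast
  \<comment> \<open>By the product rule, \<open>\<sigma> * h\<close> and its derivative are at most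
    \<open>(B' + B) * e\<close> on \<open>{-R..R}\<close> when \<open>h\<close> and its derivative
    are at most \<open>e\<close>.\<close>
  define M where "M = ((\<integral>x. \<bar>U x\<bar> \<partial>lborel) + (\<integral>x. \<bar>V x\<bar> \<partial>lborel)) * (B' + B)"
  have "\<bar>pairing U V \<psi>\<bar> \<le> M * e" if e: "e > 0" for e
  proof -
    obtain c n where cn:
      "\<And>x. x \<in> {-R..R} \<Longrightarrow> \<bar>g x - (\<Sum>i\<le>n::nat. c i * x ^ i)\<bar> \<le> e"
      "\<And>x. x \<in> {-R..R} \<Longrightarrow> \<bar>partial 1 g x - partial 1 (\<lambda>x. \<Sum>i\<le>n. c i * x ^ i) x\<bar> \<le> e"
      using C_1_polynomial_approx[OF g e R] by blast
    define q where "q x = (\<Sum>i\<le>n::nat. c i * x ^ i)" for x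
    have q: "C_k (Suc 0) q"
      unfolding q_def[abs_def] by (intro C_k_sum C_k_mult C_k_const C_k_power C_k_id)
    define h where "h x = g x + (- 1) * q x" for x
    have h: "C_k (Suc 0) h"
      unfolding h_def[abs_def] by (intro C_k_add C_k_mult C_k_const g q)
    have h': "partial 1 h x = partial 1 g x - partial 1 q x" for x
      unfolding h_def[abs_def]
      using partial_real_add[OF g C_k_mult[OF C_k_const q], of "-1" x] partial_real_cmult[OF q, of "-1" x]
      by simp
    \<comment> \<open>Expanded, this is a finite linear combination of bumps times monomials, hence
      annihilated by the pairing.\<close>
    have "(\<lambda>x. \<sigma> x * q x) = (\<lambda>x. \<Sum>p\<in>S. \<Sum>i\<le>n. c i * (bump 1 (fst p) (snd p) x * x ^ i))"
      by (auto simp: fun_eq_iff \<sigma>_def q_def sum_product split_beta intro!: sum.cong)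
    then have "pairing U V (\<lambda>x. \<sigma> x * q x)
        = pairing U V (\<lambda>x. \<Sum>p\<in>S. \<Sum>i\<le>n. c i * (bump 1 (fst p) (snd p) x * x ^ i))"
      by (rule arg_cong)
    also have "\<dots> = (\<Sum>p\<in>S. pairing U V (\<lambda>x. \<Sum>i\<le>n. c i * (bump 1 (fst p) (snd p) x * x ^ i)))"
      by (intro pairing_sum C_k_sum C_k_mult C_k_const C_k_bump C_k_power C_k_id)
    also have "\<dots> = (\<Sum>p\<in>S. \<Sum>i\<le>n. c i * pairing U V (\<lambda>x. bump 1 (fst p) (snd p) x * x ^ i))"
    proof (intro sum.cong refl)
      fix p
      have b: "C_k (Suc 0) (\<lambda>x. bump 1 (fst p) (snd p) x * x ^ i)" for i
        by (intro C_k_mult C_k_bump C_k_power C_k_id)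
      show "pairing U V (\<lambda>x. \<Sum>i\<le>n. c i * (bump 1 (fst p) (snd p) x * x ^ i))
          = (\<Sum>i\<le>n. c i * pairing U V (\<lambda>x. bump 1 (fst p) (snd p) x * x ^ i))"
        by (subst pairing_sum) (simp_all only: C_k_mult[OF C_k_const b] pairing_cmult[OF b])
    qed
    also have "\<dots> = 0"
      using zero by (intro sum.neutral ballI) auto
    finally have q0: "pairing U V (\<lambda>x. \<sigma> x * q x) = 0" .
    \<comment> \<open>Only the part with the approximation error \<open>h\<close> contributes to the
      pairing.\<close>
    have "\<psi> = (\<lambda>x. \<sigma> x * h x + \<sigma> x * q x)"
      by (simp add: fun_eq_iff \<psi>_eq h_def algebra_simps)
    then have "pairing U V \<psi> = pairing U V (\<lambda>x. \<sigma> x * h x)"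
      using pairing_add[OF C_k_mult[OF \<sigma> h] C_k_mult[OF \<sigma> q]] q0 by simp
    also have "\<bar>\<dots>\<bar> \<le> ((\<integral>x. \<bar>U x\<bar> \<partial>lborel) + (\<integral>x. \<bar>V x\<bar> \<partial>lborel)) * ((B' + B) * e)"
    proof (rule pairing_bound[OF C_k_mult[OF \<sigma> h]])
      fix x assume x: "x \<in> {-R..R}"
      have hx: "\<bar>h x\<bar> \<le> e" "\<bar>partial 1 h x\<bar> \<le> e"
        using cn[OF x] unfolding h' by (auto simp: h_def q_def[abs_def])
      have b: "\<bar>\<sigma> x * h x\<bar> \<le> B * e" "\<bar>partial 1 \<sigma> x * h x\<bar> \<le> B' * e" "\<bar>\<sigma> x * partial 1 h x\<bar> \<le> B * e"
        unfolding abs_mult using B B' x hx by (auto intro!: mult_mono)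
      have "0 \<le> B' * e" using B' e by simp
      then show "\<bar>\<sigma> x * h x\<bar> \<le> (B' + B) * e"
        using b by (simp add: distrib_right)
      show "\<bar>partial 1 (\<lambda>x. \<sigma> x * h x) x\<bar> \<le> (B' + B) * e"
        unfolding partial_real_mult[OF \<sigma> h] using b by (simp add: distrib_right)
    qed
    finally show ?thesis by (simp add: M_def mult.assoc)
  qed
  note le = this
  have "\<bar>pairing U V \<psi>\<bar> \<le> 0"
  proof (rule field_le_epsilon)
    fix e :: real assume "e > 0"
    have "M \<ge> 0" using B B' by (auto simp: M_def)
    \<comment> \<open>The denominator \<open>M + 1\<close> also covers \<open>M = 0\<close>.\<close>
    then have "M * (e / (M + 1)) \<le> e"
      using \<open>e > 0\<close> by (simp add: field_simps)
    with \<open>M \<ge> 0\<close> show "\<bar>pairing U V \<psi>\<bar> \<le> 0 + e"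
      using le[of "e / (M + 1)"] \<open>e > 0\<close> by simp
  qed
  then show ?thesis by simp
qed

end

section \<open>Functions with vanishing integrals over boxes\<close>

text \<open>The positive and negative parts of \<open>G\<close> are densities of two measures that
  agree on boxes. Boxes form an intersection-stable generator, so the measures are equal, and
  uniqueness of densities makes the two parts agree almost everywhere; they are never both
  positive.\<close>

lemma AE_zero_from_boxes:
  fixes G :: "'a::euclidean_space \<Rightarrow> real"
  assumes G: "integrable lborel G"
    and zero: "\<And>l u. (\<integral>x. indicator (box l u) x * G x \<partial>lborel) = 0"
  shows "AE x in lborel. G x = 0"
proof -
  have [measurable]: "G \<in> borel_measurable borel"
    using G by (simp add: borel_measurable_integrable)
  define P where "P = (\<lambda>s x. max 0 (s * G x))"
  have P: "integrable lborel (P s)" for s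
    unfolding P_def using G by (intro integrable_max) auto
  have eP: "emeasure (density lborel (\<lambda>x. ennreal (s * G x))) (box l u)
      = ennreal (\<integral>x. indicator (box l u) x * P s x \<partial>lborel)" for s l u
  proof -
    have "emeasure (density lborel (\<lambda>x. ennreal (s * G x))) (box l u)
        = (\<integral>\<^sup>+x. ennreal (indicator (box l u) x * P s x) \<partial>lborel)"
      by (subst emeasure_density)
        (auto intro!: nn_integral_cong simp: P_def indicator_def max_def ennreal_neg)
    also have "\<dots> = ennreal (\<integral>x. indicator (box l u) x * P s x \<partial>lborel)"
      using P by (intro nn_integral_eq_integral) (auto simp: P_def intro!: integrable_real_mult_indicator[where f = "P s", unfolded P_def, simplified mult.commute])
    finally show ?thesis .
  qed
  let ?E = "range (\<lambda>(a, b). box a b::'a set)"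
  let ?A = "\<lambda>n::nat. box (- (real n *\<^sub>R One)) (real n *\<^sub>R One) :: 'a set"
  \<comment> \<open>\<open>ennreal\<close> sends negative numbers to 0, so these densities are the
    positive and the negative part. The factor 1 or -1 is the parameter \<open>s\<close> of
    \<open>eP\<close>.\<close>
  have "density lborel (\<lambda>x. ennreal (1 * G x)) = density lborel (\<lambda>x. ennreal (- 1 * G x))"
  proof (rule measure_eqI_generator_eq[where E = ?E and A = ?A])
    show "Int_stable ?E"
      by (auto simp: Int_stable_def box_Int_box)
    show "?E \<subseteq> Pow UNIV" by simp
    show "sets (density lborel (\<lambda>x. ennreal (1 * G x))) = sigma_sets UNIV ?E"
      "sets (density lborel (\<lambda>x. ennreal (- 1 * G x))) = sigma_sets UNIV ?E"
      by (simp_all add: borel_eq_box)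
    show "range ?A \<subseteq> ?E" "(\<Union>i. ?A i) = UNIV"
      unfolding UN_box_eq_UNIV by auto
    show "emeasure (density lborel (\<lambda>x. ennreal (1 * G x))) (?A i) \<noteq> \<infinity>" for i
      unfolding eP by simp
    fix X assume "X \<in> ?E"
    then obtain l u where X: "X = box l u" by auto
    have I: "integrable lborel (\<lambda>x. indicator (box l u) x * P s x)" for s
      using integrable_real_mult_indicator[OF _ P, of "box l u" s] by (simp add: mult.commute)
    have "(\<integral>x. indicator (box l u) x * P 1 x \<partial>lborel) - (\<integral>x. indicator (box l u) x * P (- 1) x \<partial>lborel)
        = (\<integral>x. indicator (box l u) x * G x \<partial>lborel)"
      by (subst Bochner_Integration.integral_diff[OF I I, symmetric])
        (auto intro!: Bochner_Integration.integral_cong simp: P_def max_def indicator_def)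
    then show "emeasure (density lborel (\<lambda>x. ennreal (1 * G x))) X = emeasure (density lborel (\<lambda>x. ennreal (- 1 * G x))) X"
      unfolding X eP using zero[of l u] by simp
  qed
  then have "AE x in lborel. ennreal (1 * G x) = ennreal (- 1 * G x)"
    by (intro sigma_finite_measure.density_unique[OF lborel.sigma_finite_measure_axioms]) auto
  then show ?thesis
  proof eventually_elim
    case (elim x)
    then show ?case
      by (cases "G x \<ge> 0") (auto simp: ennreal_neg ennreal_eq_0_iff)
  qed
qed

section \<open>Splitting off coordinate \<open>k\<close>: Fubini for \<open>point\<close>\<close>

text \<open>The measure of \<open>lebesgue_rest\<close> before completion, to which the product
  theorems apply.\<close>

abbreviation rest :: "'n::finite \<Rightarrow> ('n \<Rightarrow> real) measure" where
  "rest k \<equiv> PiM (UNIV - {k}) (\<lambda>_. lborel)"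

lemma sigma_finite_rest: "sigma_finite_measure (rest k)"
proof -
  interpret finite_product_sigma_finite "\<lambda>_. lborel :: real measure" "UNIV - {k}"
    by standard auto
  show ?thesis ..
qed

lemma space_rest: "space (rest k) = extensional (UNIV - {k})"
  by (simp add: space_PiM PiE_def)

lemma point_nth: "point k s y $ i = (if i = k then s else y i)"
  by (simp add: point_def)

lemma point_mem_box:
  "point k s y \<in> box l u \<longleftrightarrow> (\<forall>i\<in>UNIV - {k}. l $ i < y i \<and> y i < u $ i) \<and> l $ k < s \<and> s < u $ k"
  unfolding mem_box_cart point_nth by force

lemma measurable_point [measurable]:
  "(\<lambda>(y, s). point k s y) \<in> rest k \<Otimes>\<^sub>M lborel \<rightarrow>\<^sub>M (borel :: (real ^ 'n::finite) measure)"
proof (rule borel_measurable_euclidean_space[THEN iffD2], intro ballI)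
  fix b :: "real ^ 'n" assume "b \<in> Basis"
  then obtain i where b: "b = axis i 1" by (auto simp: Basis_vec_def)
  show "(\<lambda>x. (case x of (y, s) \<Rightarrow> point k s y) \<bullet> b) \<in> borel_measurable (rest k \<Otimes>\<^sub>M lborel)"
  proof (cases "i = k")
    case True
    then show ?thesis by (simp add: b inner_axis split_beta point_nth)
  next
    case False
    then have "(\<lambda>x. fst x i) \<in> borel_measurable (rest k \<Otimes>\<^sub>M (lborel :: real measure))"
      by (intro measurable_compose[OF measurable_fst]) (use measurable_component_singleton[of i "UNIV - {k}" "\<lambda>_. lborel"] in auto)
    with False show ?thesis by (simp add: b inner_axis split_beta point_nth)
  qed
qed

text \<open>Lebesgue measure is determined by its values on boxes, and the preimage of a box under
  \<open>point\<close> is a product of intervals. All Fubini statements in the coordinates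
  \<open>(y, s)\<close> rest on this identity.\<close>

lemma lborel_eq_distr_point:
  "distr (rest k \<Otimes>\<^sub>M lborel) borel (\<lambda>(y, s). point k s y) = (lborel :: (real ^ 'n::finite) measure)"
proof (rule lborel_eqI[symmetric])
  interpret finite_product_sigma_finite "\<lambda>_. lborel :: real measure" "UNIV - {k}"
    by standard auto
  fix l u :: "real ^ 'n" assume le: "\<And>b. b \<in> Basis \<Longrightarrow> l \<bullet> b \<le> u \<bullet> b"
  have le': "l $ i \<le> u $ i" for i
    using le[of "axis i 1"] by (simp add: inner_axis axis_in_Basis_iff)
  have "(\<lambda>(y, s). point k s y) -` box l u \<inter> space (rest k \<Otimes>\<^sub>M lborel)
      = (Pi\<^sub>E (UNIV - {k}) (\<lambda>i. {l $ i<..<u $ i})) \<times> {l $ k<..<u $ k}" (is "?L = ?R")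
  proof (rule set_eqI)
    fix p :: "('n \<Rightarrow> real) \<times> real"
    obtain y s where p: "p = (y, s)" by (cases p)
    have "p \<in> ?L \<longleftrightarrow> point k s y \<in> box l u \<and> y \<in> extensional (UNIV - {k})"
      by (simp only: p space_pair_measure space_rest vimage_eq Int_iff prod.case mem_Times_iff
          fst_conv snd_conv space_lborel space_borel UNIV_I simp_thms)
    also have "\<dots> \<longleftrightarrow> p \<in> ?R"
      unfolding point_mem_box p mem_Times_iff PiE_iff fst_conv snd_conv greaterThanLessThan_iff by blast
    finally show "p \<in> ?L \<longleftrightarrow> p \<in> ?R" .
  qed
  then have "emeasure (distr (rest k \<Otimes>\<^sub>M lborel) borel (\<lambda>(y, s). point k s y)) (box l u)
      = emeasure (rest k) (Pi\<^sub>E (UNIV - {k}) (\<lambda>i. {l $ i<..<u $ i})) * emeasure lborel {l $ k<..<u $ k}"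
    by (simp add: emeasure_distr lborel.emeasure_pair_measure_Times sets_PiM_I_finite)
  also have "\<dots> = (\<Prod>i\<in>UNIV - {k}. ennreal (u $ i - l $ i)) * ennreal (u $ k - l $ k)"
    using le' by (simp add: emeasure_PiM)
  also have "\<dots> = (\<Prod>i\<in>UNIV. ennreal (u $ i - l $ i))"
    by (subst (2) prod.remove[of _ k]) (auto simp: mult.commute)
  also have "\<dots> = ennreal (\<Prod>i\<in>UNIV. u $ i - l $ i)"
    using le' by (intro prod_ennreal) auto
  also have "(\<Prod>i\<in>UNIV. u $ i - l $ i) = (\<Prod>b\<in>Basis. (u - l) \<bullet> b)"
  proof -
    have B: "Basis = range (\<lambda>i. axis i 1 :: real ^ 'n)" by (auto simp: Basis_vec_def)
    have "inj (\<lambda>i. axis i 1 :: real ^ 'n)" by (auto simp: inj_on_def axis_eq_axis)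
    then show ?thesis unfolding B by (subst prod.reindex) (simp_all add: inner_axis)
  qed
  finally show "emeasure (distr (rest k \<Otimes>\<^sub>M lborel) borel (\<lambda>(y, s). point k s y)) (box l u)
      = (\<Prod>b\<in>Basis. (u - l) \<bullet> b)" .
qed simp

lemma pair_sigma_finite_rest: "pair_sigma_finite (rest k) (lborel :: real measure)"
  by (intro pair_sigma_finite.intro sigma_finite_rest lborel.sigma_finite_measure_axioms)

lemma AE_point:
  fixes P :: "real ^ 'n::finite \<Rightarrow> bool"
  assumes "AE x in lborel. P x"
  shows "AE y in rest k. AE s in lborel. P (point k s y)"
proof -
  interpret pair_sigma_finite "rest k" "lborel :: real measure" by (rule pair_sigma_finite_rest)
  from assms have "AE x in distr (rest k \<Otimes>\<^sub>M lborel) borel (\<lambda>(y, s). point k s y). P x"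
    by (simp only: lborel_eq_distr_point)
  then have "AE p in rest k \<Otimes>\<^sub>M lborel. P (case p of (y, s) \<Rightarrow> point k s y)"
    by (rule AE_distrD[rotated]) simp
  from AE_pair[OF this] show ?thesis by simp
qed

lemma integrable_point:
  fixes f :: "real ^ 'n::finite \<Rightarrow> real"
  assumes f: "integrable lborel f"
  shows "(\<integral>x. f x \<partial>lborel) = (\<integral>y. \<integral>s. f (point k s y) \<partial>lborel \<partial>rest k)"
    and "AE y in rest k. integrable lborel (\<lambda>s. f (point k s y))"
    and "integrable (rest k) (\<lambda>y. \<integral>s. f (point k s y) \<partial>lborel)"
proof -
  interpret pair_sigma_finite "rest k" "lborel :: real measure" by (rule pair_sigma_finite_rest)
  have fm: "f \<in> borel_measurable borel" using f by (simp add: borel_measurable_integrable)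
  have eq: "(\<lambda>(y, s). f (point k s y)) = (\<lambda>p. f (case p of (y, s) \<Rightarrow> point k s y))" by auto
  from f have "integrable (distr (rest k \<Otimes>\<^sub>M lborel) borel (\<lambda>(y, s). point k s y)) f"
    by (simp only: lborel_eq_distr_point)
  then have I: "integrable (rest k \<Otimes>\<^sub>M lborel) (\<lambda>(y, s). f (point k s y))"
    unfolding eq by (rule integrable_distr[rotated]) simp
  show "AE y in rest k. integrable lborel (\<lambda>s. f (point k s y))"
    using AE_integrable_fst'[OF I] by simp
  show "integrable (rest k) (\<lambda>y. \<integral>s. f (point k s y) \<partial>lborel)"
    using integrable_fst'[OF I] by simp
  have "(\<integral>x. f x \<partial>lborel) = (\<integral>x. f x \<partial>distr (rest k \<Otimes>\<^sub>M lborel) borel (\<lambda>(y, s). point k s y))"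
    by (simp only: lborel_eq_distr_point)
  also have "\<dots> = (\<integral>p. f (case p of (y, s) \<Rightarrow> point k s y) \<partial>(rest k \<Otimes>\<^sub>M lborel))"
    using fm by (intro integral_distr) simp_all
  also have "\<dots> = (\<integral>y. \<integral>s. f (point k s y) \<partial>lborel \<partial>rest k)"
    using integral_fst'[OF I] unfolding eq by simp
  finally show "(\<integral>x. f x \<partial>lborel) = (\<integral>y. \<integral>s. f (point k s y) \<partial>lborel \<partial>rest k)" .
qed

text \<open>The box criterion above speaks of a euclidean space, not of functions on
  \<open>UNIV - {k}\<close>. Hence \<open>G\<close> is lifted to the full space with a cutoff in
  coordinate \<open>k\<close>, and the conclusion is read off on sections.\<close>

lemma AE_rest_zero_from_boxes:
  fixes G :: "('n::finite \<Rightarrow> real) \<Rightarrow> real"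
  assumes G: "integrable (rest k) G"
    and zero: "\<And>l u. (\<integral>y. indicator (Pi\<^sub>E (UNIV - {k}) (\<lambda>i. {l i<..<u i})) y * G y \<partial>rest k) = 0"
  shows "AE y in rest k. G y = 0"
proof -
  define r where "r x = restrict (\<lambda>i. x $ i) (UNIV - {k})" for x :: "real ^ 'n"
  have r: "r (point k s y) = y" if "y \<in> space (rest k)" for s y
    using that by (auto simp: r_def space_rest fun_eq_iff point_nth extensional_def)
  have [measurable]: "r \<in> borel \<rightarrow>\<^sub>M rest k"
    unfolding r_def[abs_def] by (intro measurable_restrict) simp
  have [measurable]: "G \<in> borel_measurable (rest k)" using G by (rule borel_measurable_integrable)
  interpret pair_sigma_finite "rest k" "lborel :: real measure" by (rule pair_sigma_finite_rest)
  \<comment> \<open>The cutoff to an interval of length 1 keeps the lift integrable, with the same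
    integral of absolute values on each section as \<open>\<bar>G y\<bar>\<close>.\<close>
  define H where "H x = indicator {0<..<1} (x $ k) * G (r x)" for x
  have Hm [measurable]: "H \<in> borel_measurable borel"
    unfolding H_def[abs_def] by measurable
  have Hp: "H (point k s y) = indicator {0<..<1} s * G y" if "y \<in> space (rest k)" for s y
    using r[OF that] by (simp add: H_def point_nth)
  have "integrable (rest k \<Otimes>\<^sub>M lborel) (\<lambda>p. H (case p of (y, s) \<Rightarrow> point k s y))"
  proof (rule Fubini_integrable)
    have "(\<integral>s. norm (H (point k s y)) \<partial>lborel) = norm (G y)" if "y \<in> space (rest k)" for y
      using that by (simp add: Hp abs_mult)
    then show "integrable (rest k) (\<lambda>y. \<integral>s. norm (H (case (y, s) of (y, s) \<Rightarrow> point k s y)) \<partial>lborel)"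
      using G by (simp cong: Bochner_Integration.integrable_cong)
    have "integrable lborel (\<lambda>s. H (point k s y))" if "y \<in> space (rest k)" for y
      unfolding Hp[OF that] by simp
    then show "AE y in rest k. integrable lborel (\<lambda>s. H (case (y, s) of (y, s) \<Rightarrow> point k s y))"
      by (intro AE_I2) simp
  qed simp
  then have "integrable (distr (rest k \<Otimes>\<^sub>M lborel) borel (\<lambda>(y, s). point k s y)) H"
    by (subst integrable_distr_eq) simp_all
  then have H: "integrable lborel H" by (simp only: lborel_eq_distr_point)
  have "(\<integral>x. indicator (box l u) x * H x \<partial>lborel) = 0" for l u
  proof -
    define B where "B = Pi\<^sub>E (UNIV - {k}) (\<lambda>i. {l $ i<..<u $ i})"
    \<comment> \<open>The integral over a box factors: the \<open>k\<close>-side contributes only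
      this length, and the other sides give the integral assumed to vanish.\<close>
    define c where "c = (\<integral>s. indicator ({l $ k<..<u $ k} \<inter> {0<..<1}) s \<partial>lborel :: real)"
    have "integrable lborel (\<lambda>x. indicator (box l u) x * H x)"
      using integrable_real_mult_indicator[OF _ H, of "box l u"] by (simp add: mult.commute)
    then have "(\<integral>x. indicator (box l u) x * H x \<partial>lborel)
        = (\<integral>y. \<integral>s. indicator (box l u) (point k s y) * H (point k s y) \<partial>lborel \<partial>rest k)"
      by (rule integrable_point(1))
    also have "\<dots> = (\<integral>y. c * (indicator B y * G y) \<partial>rest k)"
    proof (intro Bochner_Integration.integral_cong refl)
      fix y assume y: "y \<in> space (rest k)"
      have "indicator (box l u) (point k s y) * H (point k s y)
          = indicator ({l $ k<..<u $ k} \<inter> {0<..<1}) s * (indicator B y * G y)" for s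
        using y unfolding Hp[OF y]
        by (auto simp: indicator_def point_mem_box B_def PiE_iff space_rest)
      then show "(\<integral>s. indicator (box l u) (point k s y) * H (point k s y) \<partial>lborel) = c * (indicator B y * G y)"
        by (simp add: c_def)
    qed
    also have "\<dots> = 0" using zero unfolding B_def by simp
    finally show ?thesis .
  qed
  from AE_point[OF AE_zero_from_boxes[OF H this], of k]
  have "AE y in rest k. AE s in lborel. H (point k s y) = 0" .
  then show ?thesis using AE_space
  proof eventually_elim
    case (elim y)
    show ?case
    proof (rule ccontr)
      assume "G y \<noteq> 0"
      \<comment> \<open>If \<open>G y\<close> were nonzero, the lift would vanish almost everywhere
        on the section only if the unit interval were null.\<close>
      with elim have "AE s in lborel. s \<notin> {0<..<1::real}" by (simp add: Hp indicator_def)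
      then have "{0<..<1::real} \<in> null_sets lborel" by (subst AE_iff_null_sets) auto
      then show False by (simp add: null_sets_def)
    qed
  qed
qed

section \<open>Test functions and Borel representatives\<close>

lemma test_functionsI:
  assumes "\<And>n. C_k n \<phi>" "{x. \<phi> x \<noteq> 0} \<subseteq> K" "compact K" "K \<subseteq> \<Omega>"
  shows "\<phi> \<in> test_functions \<Omega>"
proof -
  have "closure {x. \<phi> x \<noteq> 0} \<subseteq> K"
    by (intro closure_minimal assms compact_imp_closed)
  moreover from this have "compact (closure {x. \<phi> x \<noteq> 0})"
    by (intro compact_closure[THEN iffD2] bounded_subset[OF compact_imp_bounded[OF assms(3)] assms(2)])
  ultimately show ?thesis
    using assms by (auto simp: test_functions_def)
qed

lemma test_functionsD:
  assumes "\<phi> \<in> test_functions \<Omega>"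
  shows "C_k n \<phi>" "compact (closure {x. \<phi> x \<noteq> 0})" "closure {x. \<phi> x \<noteq> 0} \<subseteq> \<Omega>"
  using assms by (auto simp: test_functions_def)

text \<open>Every section of a Borel function is Borel, and extension by zero turns integrals over a
  set, or over a slice varying with \<open>y\<close>, into integrals over the whole space.\<close>

definition borel_rep :: "'a::euclidean_space set \<Rightarrow> ('a \<Rightarrow> real) \<Rightarrow> ('a \<Rightarrow> real) \<Rightarrow> bool" where
  "borel_rep \<Omega> f f' \<longleftrightarrow> f' \<in> borel_measurable borel \<and> (\<forall>x. x \<notin> \<Omega> \<longrightarrow> f' x = 0) \<and>
     (AE x in lborel. x \<in> \<Omega> \<longrightarrow> f x = f' x) \<and> integrable lborel (\<lambda>x. (f' x)\<^sup>2)"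

lemma borel_rep_indicator_mult:
  assumes "borel_rep \<Omega> f f'" and [measurable]: "\<Omega> \<in> sets borel" "h \<in> borel_measurable borel"
  shows "(\<lambda>x. indicator \<Omega> x * (f x * h x)) \<in> borel_measurable lebesgue"
    and "AE x in lebesgue. indicator \<Omega> x * (f x * h x) = f' x * h x"
proof -
  have [measurable]: "f' \<in> borel_measurable borel"
    using assms by (auto simp: borel_rep_def)
  have "AE x in lborel. f' x * h x = indicator \<Omega> x * (f x * h x)"
    using assms(1) by (auto simp: borel_rep_def indicator_def elim!: eventually_mono)
  then have ae: "AE x in lebesgue. f' x * h x = indicator \<Omega> x * (f x * h x)"
    by (simp add: AE_completion_iff)
  then show "AE x in lebesgue. indicator \<Omega> x * (f x * h x) = f' x * h x"
    by (auto elim: eventually_mono)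
  show "(\<lambda>x. indicator \<Omega> x * (f x * h x)) \<in> borel_measurable lebesgue"
    by (rule borel_measurable_AE[OF _ ae]) (intro measurable_completion, simp)
qed

lemma borel_rep_integral:
  assumes "borel_rep \<Omega> f f'" and [measurable]: "\<Omega> \<in> sets borel" "h \<in> borel_measurable borel"
  shows "integral\<^sup>L (lebesgue_on \<Omega>) (\<lambda>x. f x * h x) = (\<integral>x. f' x * h x \<partial>lborel)"
proof -
  have [measurable]: "f' \<in> borel_measurable borel"
    using assms by (auto simp: borel_rep_def)
  have "integral\<^sup>L (lebesgue_on \<Omega>) (\<lambda>x. f x * h x) = (\<integral>x. indicator \<Omega> x * (f x * h x) \<partial>lebesgue)"
    by (subst integral_restrict_space) auto
  also have "\<dots> = (\<integral>x. f' x * h x \<partial>lebesgue)"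
    by (rule integral_cong_AE[OF borel_rep_indicator_mult(1)[OF assms] _ borel_rep_indicator_mult(2)[OF assms]])
      (intro measurable_completion, simp)
  also have "\<dots> = (\<integral>x. f' x * h x \<partial>lborel)"
    by (intro integral_completion) simp
  finally show ?thesis .
qed

text \<open>A Lebesgue measurable function agrees almost everywhere with a Borel one, and
  completeness of Lebesgue measure gives the way back. The second direction yields \<open>L2\<close>
  membership of the slices.\<close>

lemma L2_iff_borel_rep:
  assumes [measurable]: "\<Omega> \<in> sets borel"
  shows "f \<in> L2 \<Omega> \<longleftrightarrow> (\<exists>f'. borel_rep \<Omega> f f')"
proof
  assume f: "f \<in> L2 \<Omega>"
  define g where "g x = (if x \<in> \<Omega> then f x else 0)" for x
  have gm: "g \<in> borel_measurable lebesgue"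
    using f borel_measurable_if[of \<Omega> f] by (auto simp: L2_def g_def[abs_def])
  then obtain f0 where [measurable]: "f0 \<in> borel_measurable lborel" and ae: "AE x in lborel. g x = f0 x"
    using completion_ex_borel_measurable_real by blast
  \<comment> \<open>The indicator forces the value 0 everywhere off \<Omega>, not just almost
    everywhere.\<close>
  define f' where "f' x = indicator \<Omega> x * f0 x" for x
  have f'm [measurable]: "f' \<in> borel_measurable borel"
    unfolding f'_def[abs_def] by measurable
  have ae': "AE x in lborel. g x = f' x"
    using ae by eventually_elim (auto simp: g_def f'_def indicator_def)
  have "integrable lebesgue (\<lambda>x. indicator \<Omega> x *\<^sub>R (f x)\<^sup>2)"
    using f by (subst integrable_restrict_space[symmetric]) (auto simp: L2_def)
  then have "integrable lebesgue (\<lambda>x. (g x)\<^sup>2)"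
    by (rule Bochner_Integration.integrable_cong[THEN iffD1, rotated 2]) (auto simp: g_def)
  then have "integrable lebesgue (\<lambda>x. (f' x)\<^sup>2)"
    using gm ae' by (subst integrable_cong_AE[where g = "\<lambda>x. (g x)\<^sup>2"])
      (auto simp: AE_completion_iff elim!: eventually_mono intro!: measurable_completion)
  then have "integrable lborel (\<lambda>x. (f' x)\<^sup>2)"
    by (subst (asm) integrable_completion) auto
  with ae' have "borel_rep \<Omega> f f'"
    by (auto simp: borel_rep_def f'_def[of "_"] g_def elim!: eventually_mono)
  then show "\<exists>f'. borel_rep \<Omega> f f'" by blast
next
  assume "\<exists>f'. borel_rep \<Omega> f f'"
  then obtain f' where f': "borel_rep \<Omega> f f'" by blast
  then have [measurable]: "f' \<in> borel_measurable borel" and sq: "integrable lborel (\<lambda>x. (f' x)\<^sup>2)"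
    by (auto simp: borel_rep_def)
  have m: "(\<lambda>x. indicator \<Omega> x * f x) \<in> borel_measurable lebesgue"
    and ae: "AE x in lebesgue. indicator \<Omega> x * f x = f' x"
    using borel_rep_indicator_mult[OF f', of "\<lambda>_. 1"] by auto
  have "f \<in> borel_measurable (lebesgue_on \<Omega>)"
    using m by (subst borel_measurable_restrict_space_iff) (auto simp: mult.commute)
  moreover have "integrable lebesgue (\<lambda>x. indicator \<Omega> x *\<^sub>R (f x)\<^sup>2)"
  proof (rule integrable_cong_AE[THEN iffD2])
    show "integrable lebesgue (\<lambda>x. (f' x)\<^sup>2)"
      using sq by (subst integrable_completion) auto
    have eq: "indicator \<Omega> x *\<^sub>R (f x)\<^sup>2 = (indicator \<Omega> x * f x)\<^sup>2" for x
      by (auto simp: indicator_def)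
    show "AE x in lebesgue. indicator \<Omega> x *\<^sub>R (f x)\<^sup>2 = (f' x)\<^sup>2"
      unfolding eq using ae by eventually_elim simp
    show "(\<lambda>x. indicator \<Omega> x *\<^sub>R (f x)\<^sup>2) \<in> borel_measurable lebesgue"
      unfolding eq using m by measurable
  qed (intro measurable_completion, simp)
  ultimately show "f \<in> L2 \<Omega>"
    by (auto simp: L2_def integrable_restrict_space)
qed

text \<open>A bounded set has finite measure, and \<open>\<bar>t\<bar> \<le> 1 + t\<^sup>2\<close>;
  this is the inclusion of \<open>L^2\<close> in \<open>L^1\<close>.\<close>

lemma borel_rep_integrable:
  assumes f': "borel_rep \<Omega> f f'" and \<Omega>: "bounded \<Omega>" "\<Omega> \<in> sets borel"
  shows "integrable lborel f'"
proof (rule Bochner_Integration.integrable_bound[where f = "\<lambda>x. indicator \<Omega> x + (f' x)\<^sup>2"])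
  have "emeasure lborel \<Omega> < \<infinity>"
    by (rule emeasure_bounded_finite[OF \<Omega>(1)])
  then show "integrable lborel (\<lambda>x. indicator \<Omega> x + (f' x)\<^sup>2)"
    using f' \<Omega>(2) by (auto simp: borel_rep_def)
  have "norm (f' x) \<le> norm (indicator \<Omega> x + (f' x)\<^sup>2)" for x
  proof (cases "x \<in> \<Omega>")
    case True
    have "0 \<le> (\<bar>f' x\<bar> - 1)\<^sup>2 + \<bar>f' x\<bar>" by simp
    then have "\<bar>f' x\<bar> \<le> 1 + (f' x)\<^sup>2" by (simp add: power2_diff)
    then show ?thesis using True by simp
  qed (use f' in \<open>simp add: borel_rep_def\<close>)
  then show "AE x in lborel. norm (f' x) \<le> norm (indicator \<Omega> x + (f' x)\<^sup>2)" by simp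
qed (use f' in \<open>simp add: borel_rep_def\<close>)

section \<open>Uniqueness of the weak derivative on the line\<close>

lemma test_functions_bump:
  assumes "c > 0" "{a..b} \<subseteq> \<omega>"
  shows "bump c a b \<in> test_functions \<omega>"
proof (rule test_functionsI[OF C_k_bump])
  show "{x. bump c a b x \<noteq> 0} \<subseteq> {a..b}"
  proof
    fix x assume "x \<in> {x. bump c a b x \<noteq> 0}"
    then show "x \<in> {a..b}" using bump_eq_0[OF assms(1), of x a b] by (cases "x \<in> {a<..<b}") auto
  qed
  show "compact {a..b}" by simp
qed (fact assms(2))

lemma borel_measurable_C_k: "C_k n h \<Longrightarrow> h \<in> borel_measurable borel"
  by (intro borel_measurable_continuous_onI C_k_continuous)

text \<open>The fundamental lemma of the calculus of variations. Bumps converge to indicators of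
  intervals with closure in \<omega>, so the integrals of \<open>w\<close> over these vanish; the
  box criterion then applies on each such interval.\<close>

lemma AE_zero_from_test_functions:
  fixes \<omega> :: "real set"
  assumes \<omega>: "open \<omega>" and w: "integrable lborel w"
    and zero: "\<And>\<psi>. \<psi> \<in> test_functions \<omega> \<Longrightarrow> (\<integral>x. w x * \<psi> x \<partial>lborel) = 0"
  shows "AE x in lborel. x \<in> \<omega> \<longrightarrow> w x = 0"
proof -
  have [measurable]: "w \<in> borel_measurable borel"
    using w by (simp add: borel_measurable_integrable)
  have interval: "(\<integral>x. w x * indicator {a<..<b} x \<partial>lborel) = 0" if ab: "{a..b} \<subseteq> \<omega>" for a b
  proof -
    have "(\<lambda>n. \<integral>x. w x * bump (Suc n) a b x \<partial>lborel) \<longlonglongrightarrow> (\<integral>x. w x * indicator {a<..<b} x \<partial>lborel)"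
    proof (rule integral_dominated_convergence[where w = "\<lambda>x. \<bar>w x\<bar>"])
      show "AE x in lborel. (\<lambda>n. w x * bump (Suc n) a b x) \<longlonglongrightarrow> w x * indicator {a<..<b} x"
        by (intro AE_I2 tendsto_mult_left bump_tendsto_indicator)
      show "AE x in lborel. norm (w x * bump (Suc n) a b x) \<le> \<bar>w x\<bar>" for n
        using bump_bounds by (auto simp: abs_mult intro!: AE_I2 mult_left_le)
    qed (use w borel_measurable_C_k[OF C_k_bump] in auto)
    moreover have "(\<integral>x. w x * bump (Suc n) a b x \<partial>lborel) = 0" for n
      by (intro zero test_functions_bump ab) simp
    ultimately show ?thesis by (simp add: LIMSEQ_const_iff)
  qed
  have "AE x in lborel. x \<in> {a<..<b} \<longrightarrow> w x = 0" if ab: "{a..b} \<subseteq> \<omega>" for a b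
  proof -
    have "AE x in lborel. w x * indicator {a<..<b} x = 0"
    proof (rule AE_zero_from_boxes)
      show "integrable lborel (\<lambda>x. w x * indicator {a<..<b} x)"
        using integrable_real_mult_indicator[OF _ w, of "{a<..<b}"] by simp
      fix l u :: real
      have "(\<integral>x. indicator (box l u) x * (w x * indicator {a<..<b} x) \<partial>lborel)
          = (\<integral>x. w x * indicator {max a l<..<min b u} x \<partial>lborel)"
        by (intro Bochner_Integration.integral_cong) (auto simp: indicator_def box_real)
      \<comment> \<open>Intersecting with a box shrinks the interval, so its closure stays inside
        \<omega>; it may be empty.\<close>
      also have "\<dots> = 0"
        using ab by (intro interval) auto
      finally show "(\<integral>x. indicator (box l u) x * (w x * indicator {a<..<b} x) \<partial>lborel) = 0" .
    qed
    then show ?thesis by eventually_elim (auto simp: indicator_def)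
  qed
  \<comment> \<open>Rational endpoints leave countably many null sets, and these intervals still
    cover the open set.\<close>
  then have "AE x in lborel. {of_rat a..of_rat b} \<subseteq> \<omega> \<longrightarrow> x \<in> {of_rat a<..<of_rat b} \<longrightarrow> w x = 0"
    for a b :: rat
    by (cases "{of_rat a..of_rat b} \<subseteq> \<omega>") auto
  then have "AE x in lborel. \<forall>a b::rat. {of_rat a..of_rat b} \<subseteq> \<omega> \<longrightarrow> x \<in> {of_rat a<..<of_rat b} \<longrightarrow> w x = 0"
    unfolding AE_all_countable by blast
  then show ?thesis
  proof eventually_elim
    case (elim x)
    show ?case
    proof
      assume "x \<in> \<omega>"
      then obtain e where e: "e > 0" "cball x e \<subseteq> \<omega>"
        using \<omega> open_contains_cball by blast
      obtain a b :: rat where "x - e < of_rat a" "of_rat a < x" "x < of_rat b" "of_rat b < x + e"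
        using of_rat_dense[of "x - e" x] of_rat_dense[of x "x + e"] e(1) by auto
      moreover from this have "{of_rat a..of_rat b} \<subseteq> cball x e"
        by (auto simp: dist_real_def)
      ultimately show "w x = 0"
        using elim[rule_format, of a b] e(2) by auto
    qed
  qed
qed

text \<open>The theorem speaks of every weak derivative \<open>Df\<close> of a slice, so exhibiting
  one of them is not the end. The difference of two is annihilated by all test functions.\<close>

lemma has_weak_deriv_unique:
  assumes \<omega>: "open \<omega>" "bounded \<omega>"
    and D: "has_weak_deriv \<omega> f D1" "has_weak_deriv \<omega> f D2"
  shows "AE x in lebesgue_on \<omega>. D1 x = D2 x"
proof -
  have [measurable]: "\<omega> \<in> sets borel" using \<omega> by simp
  obtain W1 W2 where W: "borel_rep \<omega> D1 W1" "borel_rep \<omega> D2 W2"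
    using D by (auto simp: has_weak_partial_def L2_iff_borel_rep)
  have I: "integrable lborel W1" "integrable lborel W2"
    using W \<omega> by (auto intro: borel_rep_integrable)
  have Z: "W1 x = 0" "W2 x = 0" if "x \<notin> \<omega>" for x
    using W that by (auto simp: borel_rep_def)
  obtain R where R: "\<And>x. x \<in> \<omega> \<Longrightarrow> \<bar>x\<bar> \<le> R"
    using \<omega>(2) by (auto simp: bounded_iff)
  have "AE x in lborel. x \<in> \<omega> \<longrightarrow> W1 x - W2 x = 0"
  proof (rule AE_zero_from_test_functions[OF \<omega>(1)])
    show "integrable lborel (\<lambda>x. W1 x - W2 x)" using I by simp
    fix \<psi> assume \<psi>: "\<psi> \<in> test_functions \<omega>"
    have [measurable]: "\<psi> \<in> borel_measurable borel"
      using test_functionsD(1)[OF \<psi>] by (rule borel_measurable_C_k)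
    have "integral\<^sup>L (lebesgue_on \<omega>) (\<lambda>x. D1 x * \<psi> x) = integral\<^sup>L (lebesgue_on \<omega>) (\<lambda>x. D2 x * \<psi> x)"
      using D \<psi> by (auto simp: has_weak_partial_def)
    then have "(\<integral>x. W1 x * \<psi> x \<partial>lborel) = (\<integral>x. W2 x * \<psi> x \<partial>lborel)"
      using W by (simp add: borel_rep_integral)
    moreover have "integrable lborel (\<lambda>x. W1 x * \<psi> x)" "integrable lborel (\<lambda>x. W2 x * \<psi> x)"
      using R Z by (auto intro!: integrable_mult_continuous[where R = R] I
          C_k_continuous[OF test_functionsD(1)[OF \<psi>]] simp: abs_le_iff) fastforce+
    ultimately show "(\<integral>x. (W1 x - W2 x) * \<psi> x \<partial>lborel) = 0"
      by (simp add: left_diff_distrib)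
  qed
  moreover have "AE x in lborel. x \<in> \<omega> \<longrightarrow> D1 x = W1 x" "AE x in lborel. x \<in> \<omega> \<longrightarrow> D2 x = W2 x"
    using W by (auto simp: borel_rep_def)
  ultimately have "AE x in lborel. x \<in> \<omega> \<longrightarrow> D1 x = D2 x"
    by eventually_elim auto
  then show ?thesis
    by (subst AE_restrict_space_iff) (auto simp: AE_completion_iff)
qed

section \<open>From the weak partial derivative to almost every slice\<close>

text \<open>Only the factor \<open>h\<close> involves coordinate \<open>k\<close>, so the product
  over the other coordinates passes through the derivative as a constant.\<close>

lemma product_test_function:
  fixes k :: "'n::finite" and l r :: "real ^ 'n" and \<Omega> :: "(real ^ 'n) set"
  assumes h: "\<And>n. C_k n h" "\<And>s. s \<notin> {l $ k<..<r $ k} \<Longrightarrow> h s = 0"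
    and \<eta>: "\<And>i n. C_k n (\<eta> i)" "\<And>i t. t \<notin> {l $ i<..<r $ i} \<Longrightarrow> \<eta> i t = 0"
    and lr: "cbox l r \<subseteq> \<Omega>"
  shows "(\<lambda>x. h (x $ k) * (\<Prod>i\<in>UNIV - {k}. \<eta> i (x $ i))) \<in> test_functions \<Omega>" (is "?\<phi> \<in> _")
    and "partial (axis k 1) (\<lambda>x. h (x $ k) * (\<Prod>i\<in>UNIV - {k}. \<eta> i (x $ i))) x
      = partial 1 h (x $ k) * (\<Prod>i\<in>UNIV - {k}. \<eta> i (x $ i))"
proof -
  have comp: "C_k n (\<lambda>x :: real ^ 'n. g (x $ i))" if "C_k n g" for g n i
    using C_k_compose_inner[OF that, of "axis i 1 :: real ^ 'n" 0] by (simp add: inner_axis' del: C_k.simps)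
  show "?\<phi> \<in> test_functions \<Omega>"
  proof (rule test_functionsI)
    show "C_k n ?\<phi>" for n
      by (intro C_k_mult C_k_prod comp h \<eta>)
    show "{x. ?\<phi> x \<noteq> 0} \<subseteq> cbox l r"
    proof
      fix x assume "x \<in> {x. ?\<phi> x \<noteq> 0}"
      then have nz: "h (x $ k) \<noteq> 0" "\<And>i. i \<noteq> k \<Longrightarrow> \<eta> i (x $ i) \<noteq> 0" by auto
      have "x $ i \<in> {l $ i<..<r $ i}" for i
        using nz h(2) \<eta>(2) by (cases "i = k") blast+
      then show "x \<in> cbox l r" by (auto simp: mem_box_cart less_imp_le)
    qed
  qed (use lr in auto)
  have eq: "(x + t *\<^sub>R axis k 1) $ i = (if i = k then x $ k + t else x $ i)" for t i
    by (simp add: axis_def)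
  have "((\<lambda>t. h (x $ k + t)) has_real_derivative partial 1 h (x $ k)) (at 0)"
    using C_k_Suc_real(1)[OF h(1), of "x $ k"] by (subst (asm) DERIV_iff_at_0)
  from DERIV_cmult_right[OF this, of "\<Prod>i\<in>UNIV - {k}. \<eta> i (x $ i)"]
  show "partial (axis k 1) ?\<phi> x = partial 1 h (x $ k) * (\<Prod>i\<in>UNIV - {k}. \<eta> i (x $ i))"
    unfolding partial_def eq by (intro DERIV_imp_deriv) simp
qed

lemma open_slice:
  assumes \<Omega>: "open \<Omega>"
  shows "open (slice k \<Omega> y)"
proof -
  have "continuous_on UNIV (\<lambda>s. point k s y)"
    unfolding point_def
  proof (rule continuous_on_vec_lambda)
    show "continuous_on UNIV (\<lambda>s. if i = k then s else y i)" for i by (cases "i = k") auto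
  qed
  from open_vimage[OF \<Omega> this] show ?thesis by (simp add: slice_def vimage_def)
qed

lemma slice_bounded:
  assumes \<Omega>: "bounded \<Omega>"
  shows "\<exists>R>0. slice k \<Omega> y \<subseteq> {-R..R}"
proof -
  obtain R where R: "R > 0" "\<And>x. x \<in> \<Omega> \<Longrightarrow> norm x \<le> R"
    using \<Omega> by (auto simp: bounded_pos)
  have "\<bar>s\<bar> \<le> R" if "point k s y \<in> \<Omega>" for s
    using R(2)[OF that] component_le_norm_cart[of "point k s y" k] by (simp add: point_nth)
  then show ?thesis using R(1) by (intro exI[of _ R]) (force simp: slice_def)
qed

context
  fixes k :: "'n::finite" and \<Omega> :: "(real ^ 'n) set" and u v u' v' :: "real ^ 'n \<Rightarrow> real"
  assumes \<Omega>: "open \<Omega>" "bounded \<Omega>"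
    and u': "borel_rep \<Omega> u u'" and v': "borel_rep \<Omega> v v'"
    and weak: "has_weak_partial (axis k 1) \<Omega> u v"
begin

text \<open>Coordinate \<open>k\<close> stays bounded on \<Omega>, and there a continuous
  \<open>g\<close> is bounded.\<close>

lemma borel_rep_integrable_mult:
  assumes f: "borel_rep \<Omega> f f'" and g: "continuous_on UNIV g"
  shows "integrable lborel (\<lambda>x. f' x * g (x $ k))"
proof -
  obtain R where R: "\<And>x. x \<in> \<Omega> \<Longrightarrow> norm x \<le> R"
    using \<Omega>(2) by (auto simp: bounded_iff)
  obtain B where B: "\<And>s. s \<in> {-R..R} \<Longrightarrow> \<bar>g s\<bar> \<le> B"
    using compact_continuous_bound[OF continuous_on_subset[OF g subset_UNIV]] by blast
  have f': "integrable lborel f'"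
    using \<Omega> by (intro borel_rep_integrable[OF f]) auto
  have [measurable]: "f' \<in> borel_measurable borel" "g \<in> borel_measurable borel"
    using f g by (auto simp: borel_rep_def intro: borel_measurable_continuous_onI)
  show ?thesis
  proof (rule Bochner_Integration.integrable_bound[where f = "\<lambda>x. B * f' x"])
    have "norm (f' x * g (x $ k)) \<le> norm (B * f' x)" for x
    proof (cases "x \<in> \<Omega>")
      case True
      then have "\<bar>x $ k\<bar> \<le> R" using R component_le_norm_cart[of x k] by force
      then have "\<bar>g (x $ k)\<bar> \<le> \<bar>B\<bar>" by (intro order_trans[OF B]) auto
      from mult_right_mono[OF this, of "\<bar>f' x\<bar>"] show ?thesis
        by (simp add: abs_mult mult.commute)
    qed (use f in \<open>simp add: borel_rep_def\<close>)
    then show "AE x in lborel. norm (f' x * g (x $ k)) \<le> norm (B * f' x)" by simp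
  qed (use f' in auto)
qed

text \<open>For fixed \<open>h\<close>, the pairing on the slice is a function \<open>G\<close> of
  \<open>y\<close>. Product test functions show that \<open>G\<close> has integral 0 over every
  subbox of the sides of \<open>cbox l r\<close> other than \<open>k\<close>, so \<open>G\<close>
  vanishes almost everywhere there.\<close>

lemma AE_pairing_bump_eq_0:
  assumes lr: "cbox l r \<subseteq> \<Omega>"
  shows "AE y in rest k. (\<forall>i\<in>UNIV - {k}. l $ i < y i \<and> y i < r $ i) \<longrightarrow>
    pairing (\<lambda>s. u' (point k s y)) (\<lambda>s. v' (point k s y)) (\<lambda>s. bump 1 (l $ k) (r $ k) s * s ^ m) = 0"
proof -
  define h where "h s = bump 1 (l $ k) (r $ k) s * s ^ m" for s
  have h: "C_k n h" for n
    unfolding h_def[abs_def] by (intro C_k_mult C_k_bump C_k_power C_k_id)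
  have h0: "h s = 0" if "s \<notin> {l $ k<..<r $ k}" for s
    using bump_eq_0[OF _ that, of 1] by (simp add: h_def)
  have hc: "continuous_on UNIV h" "continuous_on UNIV (partial 1 h)"
    by (intro C_1_real_continuous h)+
  have [measurable]: "h \<in> borel_measurable borel" "partial 1 h \<in> borel_measurable borel"
    using hc by (auto intro: borel_measurable_continuous_onI)
  have [measurable]: "u' \<in> borel_measurable borel" "v' \<in> borel_measurable borel"
    using u' v' by (auto simp: borel_rep_def)
  have [measurable]: "\<Omega> \<in> sets borel" using \<Omega> by simp
  define f where "f x = u' x * partial 1 h (x $ k) + v' x * h (x $ k)" for x
  have f: "integrable lborel f"
    unfolding f_def by (intro Bochner_Integration.integrable_add borel_rep_integrable_mult[OF u'] borel_rep_integrable_mult[OF v'] hc)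
  define G where "G y = (\<integral>s. f (point k s y) \<partial>lborel)" for y
  have G_eq: "G y = pairing (\<lambda>s. u' (point k s y)) (\<lambda>s. v' (point k s y)) h" for y
    by (simp add: G_def f_def pairing_def point_nth)
  have G: "integrable (rest k) G"
    unfolding G_def by (rule integrable_point(3)[OF f])
  have [measurable]: "G \<in> borel_measurable (rest k)"
    using G by (rule borel_measurable_integrable)
  \<comment> \<open>Staying within the sides of \<open>cbox l r\<close> is what makes the products
    admissible test functions. Degenerate boxes are included: then both bump and indicator are
    0.\<close>
  have zero: "(\<integral>y. indicator (Pi\<^sub>E (UNIV - {k}) (\<lambda>i. {p i<..<q i})) y * G y \<partial>rest k) = 0"
    if pq: "\<And>i. l $ i \<le> p i" "\<And>i. q i \<le> r $ i" for p q
  proof -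
    define \<eta> where "\<eta> n i = bump (Suc n) (p i) (q i)" for n :: nat and i
    define E where "E n y = (\<Prod>i\<in>UNIV - {k}. \<eta> n i (y i))" for n and y :: "'n \<Rightarrow> real"
    have \<eta>: "C_k j (\<eta> n i)" "0 \<le> \<eta> n i t" "\<eta> n i t \<le> 1" for j n i t
      unfolding \<eta>_def by (intro C_k_bump bump_bounds)+
    have \<eta>0: "\<eta> n i t = 0" if "t \<notin> {l $ i<..<r $ i}" for n i t
      unfolding \<eta>_def using that pq[of i] by (intro bump_eq_0) auto
    have E01: "0 \<le> E n y" "E n y \<le> 1" for n y
      unfolding E_def by (intro prod_nonneg prod_le_1 ballI conjI \<eta>)+
    have [measurable]: "\<eta> n i \<in> borel_measurable borel" for n i
      using \<eta>(1) by (rule borel_measurable_C_k)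
    have [measurable]: "E n \<in> borel_measurable (rest k)" for n
      unfolding E_def[abs_def] by measurable
    \<comment> \<open>The factor \<open>e\<close> is independent of coordinate \<open>k\<close>. It
      leaves the inner Fubini integral as \<open>E n y\<close>, and what remains inside is
      \<open>G y\<close>.\<close>
    have E0: "(\<integral>y. E n y * G y \<partial>rest k) = 0" for n
    proof -
      define e where "e x = (\<Prod>i\<in>UNIV - {k}. \<eta> n i (x $ i))" for x :: "real ^ 'n"
      have e01: "0 \<le> e x" "e x \<le> 1" for x
        unfolding e_def by (intro prod_nonneg prod_le_1 ballI conjI \<eta>)+
      have [measurable]: "e \<in> borel_measurable borel"
        unfolding e_def[abs_def] by measurable
      have e_point: "e (point k s y) = E n y" for s y
        unfolding e_def E_def by (intro prod.cong) (auto simp: point_nth)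
      have I: "integrable lborel (\<lambda>x. g x * e x)" if g: "integrable lborel g" for g
      proof (rule Bochner_Integration.integrable_bound[OF g])
        show "AE x in lborel. norm (g x * e x) \<le> norm (g x)"
          using e01 by (auto simp: abs_mult intro!: AE_I2 mult_left_le)
      qed (use g in simp)
      define \<phi> where "\<phi> x = h (x $ k) * e x" for x
      have \<phi>: "\<phi> \<in> test_functions \<Omega>"
        unfolding \<phi>_def[abs_def] e_def by (rule product_test_function(1)[OF h h0 \<eta>(1) \<eta>0 lr])
      have d\<phi>: "partial (axis k 1) \<phi> = (\<lambda>x. partial 1 h (x $ k) * e x)"
        unfolding \<phi>_def[abs_def] e_def by (rule ext, rule product_test_function(2)[OF h h0 \<eta>(1) \<eta>0 lr])
      have "(\<integral>x. u' x * (partial 1 h (x $ k) * e x) \<partial>lborel) = - (\<integral>x. v' x * \<phi> x \<partial>lborel)"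
      proof -
        have "integral\<^sup>L (lebesgue_on \<Omega>) (\<lambda>x. u x * partial (axis k 1) \<phi> x) =
            - integral\<^sup>L (lebesgue_on \<Omega>) (\<lambda>x. v x * \<phi> x)"
          using weak \<phi> by (auto simp: has_weak_partial_def)
        then show ?thesis
          unfolding d\<phi> by (simp add: borel_rep_integral[OF u'] borel_rep_integral[OF v'] \<phi>_def)
      qed
      moreover have "(\<integral>x. f x * e x \<partial>lborel)
          = (\<integral>x. u' x * (partial 1 h (x $ k) * e x) \<partial>lborel) + (\<integral>x. v' x * \<phi> x \<partial>lborel)"
        using I[OF borel_rep_integrable_mult[OF u' hc(2)]] I[OF borel_rep_integrable_mult[OF v' hc(1)]]
        by (subst Bochner_Integration.integral_add[symmetric])
          (auto simp: f_def \<phi>_def algebra_simps)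
      moreover have "(\<integral>x. f x * e x \<partial>lborel) = (\<integral>y. E n y * G y \<partial>rest k)"
        by (subst integrable_point(1)[OF I[OF f], of k]) (simp add: e_point G_def mult.commute)
      ultimately show ?thesis by simp
    qed
    \<comment> \<open>Since \<open>0 \<le> E n y \<le> 1\<close>, dominated convergence applies with
      \<open>\<bar>G y\<bar>\<close> as the bound.\<close>
    have "(\<lambda>n. \<integral>y. E n y * G y \<partial>rest k) \<longlonglongrightarrow> (\<integral>y. indicator (Pi\<^sub>E (UNIV - {k}) (\<lambda>i. {p i<..<q i})) y * G y \<partial>rest k)"
    proof (rule integral_dominated_convergence[where w = "\<lambda>y. \<bar>G y\<bar>"])
      have "(\<lambda>n. E n y) \<longlonglongrightarrow> indicator (Pi\<^sub>E (UNIV - {k}) (\<lambda>i. {p i<..<q i})) y" if y: "y \<in> space (rest k)" for y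
      proof -
        have "(\<lambda>n. E n y) \<longlonglongrightarrow> (\<Prod>i\<in>UNIV - {k}. indicator {p i<..<q i} (y i))"
          unfolding E_def \<eta>_def by (intro tendsto_prod bump_tendsto_indicator)
        also have "(\<Prod>i\<in>UNIV - {k}. indicator {p i<..<q i} (y i)) = (indicator (Pi\<^sub>E (UNIV - {k}) (\<lambda>i. {p i<..<q i})) y :: real)"
          using y by (auto simp: indicator_def PiE_iff space_rest)
        finally show ?thesis .
      qed
      then show "AE y in rest k. (\<lambda>n. E n y * G y) \<longlonglongrightarrow> indicator (Pi\<^sub>E (UNIV - {k}) (\<lambda>i. {p i<..<q i})) y * G y"
        by (intro AE_I2 tendsto_mult_right)
      show "AE y in rest k. norm (E n y * G y) \<le> \<bar>G y\<bar>" for n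
        using E01 by (auto simp: abs_mult intro!: AE_I2 mult_left_le_one_le)
    qed (use G in auto)
    then show ?thesis unfolding E0 by (simp add: LIMSEQ_const_iff)
  qed
  define J where "J = Pi\<^sub>E (UNIV - {k}) (\<lambda>i. {l $ i<..<r $ i})"
  have J: "J \<in> sets (rest k)" unfolding J_def by (intro sets_PiM_I_finite) auto
  have "AE y in rest k. indicator J y * G y = 0"
  proof (rule AE_rest_zero_from_boxes)
    show "integrable (rest k) (\<lambda>y. indicator J y * G y)"
      using integrable_real_mult_indicator[OF J G] by (simp add: mult.commute)
    fix p q :: "'n \<Rightarrow> real"
    \<comment> \<open>Multiplying by the indicator of \<open>J\<close> cuts an arbitrary box down to
      one covered by \<open>zero\<close>.\<close>
    have eq: "indicator (Pi\<^sub>E (UNIV - {k}) (\<lambda>i. {p i<..<q i})) y * (indicator J y * G y)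
        = indicator (Pi\<^sub>E (UNIV - {k}) (\<lambda>i. {max (l $ i) (p i)<..<min (r $ i) (q i)})) y * G y" for y
      by (auto simp: indicator_def J_def PiE_iff)
    show "(\<integral>y. indicator (Pi\<^sub>E (UNIV - {k}) (\<lambda>i. {p i<..<q i})) y * (indicator J y * G y) \<partial>rest k) = 0"
      unfolding eq by (rule zero) auto
  qed
  then show ?thesis using AE_space
  proof eventually_elim
    case (elim y)
    then show ?case
      unfolding G_eq h_def[abs_def] by (auto simp: indicator_def J_def PiE_iff space_rest)
  qed
qed

text \<open>Functions from a finite type to the rationals are countable, as are the exponents
  \<open>m\<close>, so one null set of \<open>y\<close> serves all boxes and monomials.\<close>

lemma AE_slice_pairing_bump_eq_0:
  "AE y in rest k. \<forall>l r :: 'n \<Rightarrow> rat. \<forall>m.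
    cbox (\<chi> i. of_rat (l i)) (\<chi> i. of_rat (r i)) \<subseteq> \<Omega> \<longrightarrow>
    (\<forall>i\<in>UNIV - {k}. of_rat (l i) < y i \<and> y i < of_rat (r i)) \<longrightarrow>
    pairing (\<lambda>s. u' (point k s y)) (\<lambda>s. v' (point k s y))
      (\<lambda>s. bump 1 (of_rat (l k)) (of_rat (r k)) s * s ^ m) = 0"
  unfolding AE_all_countable
proof (intro allI)
  fix l r :: "'n \<Rightarrow> rat" and m
  show "AE y in rest k. cbox (\<chi> i. of_rat (l i)) (\<chi> i. of_rat (r i)) \<subseteq> \<Omega> \<longrightarrow>
    (\<forall>i\<in>UNIV - {k}. of_rat (l i) < y i \<and> y i < of_rat (r i)) \<longrightarrow>
    pairing (\<lambda>s. u' (point k s y)) (\<lambda>s. v' (point k s y))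
      (\<lambda>s. bump 1 (of_rat (l k)) (of_rat (r k)) s * s ^ m) = 0"
    using AE_pairing_bump_eq_0[of "\<chi> i. of_rat (l i)" "\<chi> i. of_rat (r i)" m]
    by (cases "cbox (\<chi> i. of_rat (l i)) (\<chi> i. of_rat (r i)) \<subseteq> \<Omega>") simp_all
qed

text \<open>Measurability and vanishing off the slice hold for every \<open>y\<close> in the space;
  only agreement with \<open>f\<close> and square integrability cost a null set, by Fubini.\<close>

lemma AE_borel_rep_slice:
  assumes f: "borel_rep \<Omega> f f'"
  shows "AE y in rest k. borel_rep (slice k \<Omega> y) (\<lambda>s. f (point k s y)) (\<lambda>s. f' (point k s y))"
proof -
  have f'm: "f' \<in> borel_measurable borel" using f by (simp add: borel_rep_def)
  have m: "(\<lambda>s. f' (point k s y)) \<in> borel_measurable borel" if y: "y \<in> space (rest k)" for y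
  proof -
    have "(\<lambda>s. (\<lambda>(y, s). point k s y) (y, s)) \<in> lborel \<rightarrow>\<^sub>M (borel :: (real ^ 'n) measure)"
      by (rule measurable_compose_Pair1[OF y measurable_point])
    then show ?thesis using measurable_compose[OF _ f'm] by simp
  qed
  have "AE y in rest k. AE s in lborel. point k s y \<in> \<Omega> \<longrightarrow> f (point k s y) = f' (point k s y)"
    using f by (intro AE_point) (auto simp: borel_rep_def)
  moreover have "AE y in rest k. integrable lborel (\<lambda>s. (f' (point k s y))\<^sup>2)"
    using f by (intro integrable_point(2)[of "\<lambda>x. (f' x)\<^sup>2"]) (auto simp: borel_rep_def)
  ultimately show ?thesis using AE_space
    by eventually_elim (use f m in \<open>auto simp: borel_rep_def slice_def\<close>)
qed

text \<open>For a good \<open>y\<close>, each support point lies in a rational box with closure in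
  \<Omega>. The \<open>k\<close>-sides of these boxes cover the support, and compactness leaves the
  finitely many intervals that \<open>pairing_eq_0_from_bumps\<close> requires.\<close>

lemma AE_has_weak_deriv_slice:
  "AE y in rest k. has_weak_deriv (slice k \<Omega> y) (\<lambda>s. u (point k s y)) (\<lambda>s. v (point k s y)) \<and>
    (\<lambda>s. u (point k s y)) \<in> L2 (slice k \<Omega> y)"
  using AE_slice_pairing_bump_eq_0 AE_borel_rep_slice[OF u'] AE_borel_rep_slice[OF v']
proof eventually_elim
  case (elim y)
  define \<omega> where "\<omega> = slice k \<Omega> y"
  define U where "U s = u' (point k s y)" for s
  define V where "V s = v' (point k s y)" for s
  have \<omega>: "open \<omega>" "\<omega> \<in> sets borel" using open_slice[OF \<Omega>(1)] by (auto simp: \<omega>_def)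
  obtain R where R: "R > 0" "\<omega> \<subseteq> {-R..R}"
    using slice_bounded[OF \<Omega>(2), of k y] by (auto simp: \<omega>_def)
  then have b: "bounded \<omega>" by (meson bounded_closed_interval bounded_subset)
  have U: "borel_rep \<omega> (\<lambda>s. u (point k s y)) U" and V: "borel_rep \<omega> (\<lambda>s. v (point k s y)) V"
    using elim by (simp_all add: \<omega>_def U_def[abs_def] V_def[abs_def])
  note L2 = L2_iff_borel_rep[OF \<omega>(2), THEN iffD2, OF exI[of _ U], OF U]
    L2_iff_borel_rep[OF \<omega>(2), THEN iffD2, OF exI[of _ V], OF V]
  have UV: "integrable lborel U" "\<And>s. s \<notin> {-R..R} \<Longrightarrow> U s = 0"
    "integrable lborel V" "\<And>s. s \<notin> {-R..R} \<Longrightarrow> V s = 0"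
    using borel_rep_integrable[OF U b \<omega>(2)] borel_rep_integrable[OF V b \<omega>(2)] U V R(2)
    by (auto simp: borel_rep_def)
  have "integral\<^sup>L (lebesgue_on \<omega>) (\<lambda>s. u (point k s y) * partial 1 \<psi> s) =
      - integral\<^sup>L (lebesgue_on \<omega>) (\<lambda>s. v (point k s y) * \<psi> s)"
    if \<psi>: "\<psi> \<in> test_functions \<omega>" for \<psi>
  proof -
    note \<psi>C = test_functionsD(1)[OF \<psi>]
    let ?K = "closure {s. \<psi> s \<noteq> 0}"
    have "\<forall>s\<in>?K. \<exists>p. s \<in> {fst p<..<snd p} \<and> (\<forall>m. pairing U V (\<lambda>t. bump 1 (fst p) (snd p) t * t ^ m) = 0)"
    proof
      fix s assume s: "s \<in> ?K"
      have "point k s y \<in> \<Omega>"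
        using s test_functionsD(3)[OF \<psi>] by (auto simp: \<omega>_def slice_def)
      then obtain e where e: "e > 0" "cball (point k s y) e \<subseteq> \<Omega>"
        using \<Omega>(1) open_contains_cball by blast
      obtain a b where ab: "\<forall>i\<in>Basis. a \<bullet> i \<in> \<rat> \<and> b \<bullet> i \<in> \<rat>" "point k s y \<in> box a b"
        "box a b \<subseteq> ball (point k s y) e"
        using rational_boxes[OF e(1)] by blast
      have "\<exists>q. a $ i = of_rat q" "\<exists>q. b $ i = of_rat q" for i
        using ab(1)[rule_format, of "axis i 1"]
        by (auto simp: inner_axis axis_in_Basis_iff elim!: Rats_cases)
      then obtain l r where lr: "\<And>i. a $ i = of_rat (l i)" "\<And>i. b $ i = of_rat (r i)"
        by metis
      have eq: "a = (\<chi> i. of_rat (l i))" "b = (\<chi> i. of_rat (r i))"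
        using lr by (simp_all add: vec_eq_iff)
      \<comment> \<open>A nonempty open box has the closed box as closure; \<open>ab(2)\<close>
        supplies nonemptiness. The closed box must lie in \<Omega> for the countable family to
        include it.\<close>
      have "cbox a b \<subseteq> cball (point k s y) e"
        using closure_mono[OF ab(3)] ab(2) e(1) by (subst (asm) closure_box) auto
      with e(2) have "cbox a b \<subseteq> \<Omega>" by blast
      then show "\<exists>p. s \<in> {fst p<..<snd p} \<and> (\<forall>m. pairing U V (\<lambda>t. bump 1 (fst p) (snd p) t * t ^ m) = 0)"
        using elim(1) ab(2) unfolding point_mem_box eq U_def V_def
        by (intro exI[of _ "(of_rat (l k), of_rat (r k))"]) simp
    qed
    from bchoice[OF this] obtain p where p: "\<forall>s\<in>?K. s \<in> {fst (p s)<..<snd (p s)} \<and>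
        (\<forall>m. pairing U V (\<lambda>t. bump 1 (fst (p s)) (snd (p s)) t * t ^ m) = 0)" by blast
    then have "?K \<subseteq> (\<Union>s\<in>?K. {fst (p s)<..<snd (p s)})" by blast
    then obtain F where F: "F \<subseteq> ?K" "finite F" "?K \<subseteq> (\<Union>s\<in>F. {fst (p s)<..<snd (p s)})"
      by (rule compactE_image[OF test_functionsD(2)[OF \<psi>], rotated]) auto
    have "pairing U V \<psi> = 0"
    proof (rule pairing_eq_0_from_bumps[OF UV R(1) \<psi>C, where S = "p ` F"])
      show "finite (p ` F)" using F(2) by simp
      show "?K \<subseteq> (\<Union>q\<in>p ` F. {fst q<..<snd q})" using F(3) by simp
      fix a b m assume "(a, b) \<in> p ` F"
      then obtain s where "s \<in> ?K" "p s = (a, b)" using F(1) by force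
      then show "pairing U V (\<lambda>t. bump 1 a b t * t ^ m) = 0" using p by force
    qed
    then have "(\<integral>s. U s * partial 1 \<psi> s \<partial>lborel) + (\<integral>s. V s * \<psi> s \<partial>lborel) = 0"
      unfolding pairing_def using integrable_pairing[OF UV \<psi>C] by simp
    moreover have "\<psi> \<in> borel_measurable borel" "partial 1 \<psi> \<in> borel_measurable borel"
      using borel_measurable_C_k[OF \<psi>C[of 0]] borel_measurable_C_k[OF C_k_Suc_real(2)[OF \<psi>C[of "Suc 0"]]] by simp_all
    ultimately show ?thesis
      using borel_rep_integral[OF U \<omega>(2)] borel_rep_integral[OF V \<omega>(2)] by simp
  qed
  with L2 show ?case
    by (auto simp: has_weak_partial_def \<omega>_def)
qed

end

section \<open>Measurability of the projection and the conclusion\<close>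

text \<open>A projection of a Borel set need not be Borel. Here the slices are open, so a nonempty
  one contains a rational, and the projection is a countable union of measurable sections.\<close>

lemma proj_sets:
  assumes \<Omega>: "open \<Omega>"
  shows "proj k \<Omega> \<in> sets (rest k)"
proof -
  have "proj k \<Omega> = (\<Union>q::rat. {y \<in> space (rest k). point k (of_rat q) y \<in> \<Omega>})"
  proof (intro equalityI subsetI)
    fix y assume "y \<in> proj k \<Omega>"
    then obtain s where y: "y \<in> extensional (UNIV - {k})" and s: "s \<in> slice k \<Omega> y"
      by (auto simp: proj_def slice_def)
    obtain e where e: "e > 0" "ball s e \<subseteq> slice k \<Omega> y"
      using s open_slice[OF \<Omega>] open_contains_ball by blast
    moreover obtain q :: rat where "s < of_rat q" "of_rat q < s + e"
      using of_rat_dense[of s "s + e"] e by auto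
    ultimately have "of_rat q \<in> slice k \<Omega> y" by (auto simp: dist_real_def)
    then show "y \<in> (\<Union>q::rat. {y \<in> space (rest k). point k (of_rat q) y \<in> \<Omega>})"
      using y by (auto simp: space_rest slice_def)
  qed (auto simp: proj_def space_rest)
  moreover have "{y \<in> space (rest k). point k s y \<in> \<Omega>} \<in> sets (rest k)" for s
  proof -
    have "(\<lambda>y. (\<lambda>(y, s). point k s y) (y, s)) \<in> rest k \<rightarrow>\<^sub>M (borel :: (real ^ _) measure)"
      by (rule measurable_compose[OF measurable_Pair2' measurable_point]) simp
    from measurable_sets[OF this borel_open[OF \<Omega>]] show ?thesis
      by (simp add: vimage_def Int_def conj_commute)
  qed
  ultimately show ?thesis
    by (simp only:) (rule sets.countable_UN', auto)
qed

theorem lemmaA1: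
  fixes k :: "'n::finite"
    and \<Omega> :: "(real ^ 'n) set"
    and u d1u :: "real ^ 'n \<Rightarrow> real"
  assumes "open \<Omega>" and "bounded \<Omega>" and "\<Omega> \<noteq> {}"
    and "u \<in> W (axis k 1) \<Omega>"
    and "has_weak_partial (axis k 1) \<Omega> u d1u"
  shows "\<exists>A. A \<subseteq> proj k \<Omega> \<and> A \<in> sets (lebesgue_rest k) \<and>
      proj k \<Omega> - A \<in> null_sets (lebesgue_rest k) \<and>
      (\<forall>y\<in>A. (\<lambda>s. u (point k s y)) \<in> H1 (slice k \<Omega> y) \<and>
         (\<forall>Df. has_weak_deriv (slice k \<Omega> y) (\<lambda>s. u (point k s y)) Df \<longrightarrow>
            (AE s in lebesgue_on (slice k \<Omega> y). Df s = d1u (point k s y))))"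
proof -
  have \<Omega>: "open \<Omega>" "bounded \<Omega>" "\<Omega> \<in> sets borel" using assms(1,2) by auto
  obtain u' v' where reps: "borel_rep \<Omega> u u'" "borel_rep \<Omega> d1u v'"
    using assms(4,5) L2_iff_borel_rep[OF \<Omega>(3)] by (auto simp: W_def has_weak_partial_def)
  let ?P = "\<lambda>y. has_weak_deriv (slice k \<Omega> y) (\<lambda>s. u (point k s y)) (\<lambda>s. d1u (point k s y)) \<and>
    (\<lambda>s. u (point k s y)) \<in> L2 (slice k \<Omega> y)"
  \<comment> \<open>The exceptional set is enlarged to a measurable null set of the uncompleted
    measure, so removing it from the projection keeps measurability.\<close>
  obtain N where N: "N \<in> null_sets (rest k)" "\<And>y. y \<in> space (rest k) - N \<Longrightarrow> ?P y"
    using AE_E3[OF AE_has_weak_deriv_slice[OF \<Omega>(1,2) reps assms(5)]] by blast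
  have pr: "proj k \<Omega> \<in> sets (rest k)" by (rule proj_sets[OF \<Omega>(1)])
  show ?thesis
  proof (intro exI conjI ballI allI impI)
    show "proj k \<Omega> - N \<subseteq> proj k \<Omega>" by blast
    show "proj k \<Omega> - N \<in> sets (lebesgue_rest k)"
      using pr N(1) by (auto simp: lebesgue_rest_def null_sets_def)
    have "proj k \<Omega> - (proj k \<Omega> - N) = N \<inter> proj k \<Omega>" by blast
    then show "proj k \<Omega> - (proj k \<Omega> - N) \<in> null_sets (lebesgue_rest k)"
      using null_set_Int2[OF N(1) pr] by (auto simp: lebesgue_rest_def null_sets_completionI Int_commute)
    fix y assume y: "y \<in> proj k \<Omega> - N"
    then have P: "?P y" using N(2) by (auto simp: proj_def space_rest)
    then show "(\<lambda>s. u (point k s y)) \<in> H1 (slice k \<Omega> y)" by (auto simp: W_def)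
    fix Df assume Df: "has_weak_deriv (slice k \<Omega> y) (\<lambda>s. u (point k s y)) Df"
    obtain R where "slice k \<Omega> y \<subseteq> {-R..R}" using slice_bounded[OF \<Omega>(2)] by blast
    then have "bounded (slice k \<Omega> y)" by (meson bounded_closed_interval bounded_subset)
    then show "AE s in lebesgue_on (slice k \<Omega> y). Df s = d1u (point k s y)"
      using P Df by (intro has_weak_deriv_unique open_slice) (use \<Omega> in auto)
  qed
qed

end
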